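(* Let $q$ be a (complex-valued) function with $q,q_1\in L^\infty(\mathbb R)$, where $q_1(x)=\int_0^xq(t)dt$. Then: (i) For every $\lambda\in\mathbb C$ there exist unique solutions $\psi_\pm(x,\lambda)$ of $-y''+(x^2+q(x))y=\lambda y$ satisfying, as $x\to\pm\infty$ and locally uniformly in $\lambda$, $$\psi_\pm(x,\lambda)=(\pm\sqrt2x)^{\frac{\lambda-1}2}e^{-x^2/2}(1+o(1)),\qquad \psi_\pm'(x,\lambda)=-x(\pm\sqrt2x)^{\frac{\lambda-1}2}e^{-x^2/2}(1+o(1)).$$ Moreover, for each fixed $x\in\mathbb R$ the functions $\lambda\mapsto\psi_\pm(x,\lambda)$, $\lambda\mapsto\psi_\pm'(x,\lambda)$ and the Wronskian $w(\lambda)=\psi_-\psi_+'-\psi_-'\psi_+$ are entire. (ii) If $q$ is real-valued, then the operator $T=-\frac{d^2}{dx^2}+x^2+q(x)$ on $L^2(\mathbb R)$ has only simple eigenvalues.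
   Context: Powers $z^\alpha$ use the principal branch. The derivative $'$ is with respect to $x$. *)

theory Defs
  imports "HOL-Analysis.Analysis"
begin

text \<open>Carath\'eodory solution of  -y'' + (x^2 + q x) y = lam y  on the whole line:
  y is differentiable with derivative y', and y' is the indefinite integral of
  (x^2 + q x - lam) y, i.e. y' is locally absolutely continuous with
  y'' = (x^2 + q - lam) y almost everywhere.\<close>
definition is_sol :: "(real \<Rightarrow> complex) \<Rightarrow> complex \<Rightarrow> (real \<Rightarrow> complex) \<Rightarrow> (real \<Rightarrow> complex) \<Rightarrow> bool" where
  "is_sol q lam y y' \<longleftrightarrow>
     (\<forall>x. (y has_vector_derivative y' x) (at x)) \<and>
     (\<forall>a b. a \<le> b \<longrightarrow>
        ((\<lambda>t. (complex_of_real (t\<^sup>2) + q t - lam) * y t) has_integral (y' b - y' a)) {a..b})"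

definition Aplus :: "real \<Rightarrow> complex \<Rightarrow> complex" where
  "Aplus x lam = complex_of_real (sqrt 2 * x) powr ((lam - 1) / 2) * exp (complex_of_real (- (x\<^sup>2) / 2))"

definition Aminus :: "real \<Rightarrow> complex \<Rightarrow> complex" where
  "Aminus x lam = complex_of_real (- sqrt 2 * x) powr ((lam - 1) / 2) * exp (complex_of_real (- (x\<^sup>2) / 2))"

definition L2 :: "(real \<Rightarrow> complex) \<Rightarrow> bool" where
  "L2 f \<longleftrightarrow> f \<in> borel_measurable lborel \<and> integrable lborel (\<lambda>x. (norm (f x))\<^sup>2)"

text \<open>Eigenfunctions of the (maximal, self-adjoint) operator T = -d^2/dx^2 + x^2 + q on L^2(R):
  f is a nonzero element of the domain (f, f' locally absolutely continuous, f in L^2,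
  Tf in L^2) with Tf = lam f. Since Tf = lam f, the condition Tf in L^2 is automatic.\<close>
definition eigenfunction :: "(real \<Rightarrow> complex) \<Rightarrow> complex \<Rightarrow> (real \<Rightarrow> complex) \<Rightarrow> bool" where
  "eigenfunction q lam f \<longleftrightarrow> L2 f \<and> (\<exists>f'. is_sol q lam f f') \<and> f \<noteq> (\<lambda>_. 0)"

definition only_simple_eigenvalues :: "(real \<Rightarrow> complex) \<Rightarrow> bool" where
  "only_simple_eigenvalues q \<longleftrightarrow>
     (\<forall>lam f g. eigenfunction q lam f \<and> eigenfunction q lam g \<longrightarrow> (\<exists>c. g = (\<lambda>x. c * f x)))"

end

theory Submission
  imports Defs "HOL-Complex_Analysis.Cauchy_Integral_Formula"
begin

text \<open>
  With \<open>q1(x) = \<integral>\<^sub>0\<^sup>x q\<close>, the pair \<open>(y, y' - q1 y)\<close> satisfies a first-order system with continuous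
  coefficients, so fundamental solutions exist and are entire in \<open>\<lambda>\<close>.
  Near \<open>+\<infinity>\<close> one compares with the approximate solution
  \<open>D = (\<surd>2 x)^((\<lambda>-1)/2) exp (-x\<^sup>2/2 + W)\<close>, where \<open>W' = w\<close> and \<open>w\<close> is the decaying solution of
  \<open>w' = 2 x w + q\<close>: boundedness of \<open>q\<close> gives \<open>w = O(1/x)\<close>, boundedness of \<open>q1\<close> gives convergence
  of \<open>W\<close>, and \<open>D\<close> solves the equation up to a relative error \<open>\<tau> = O(1/x\<^sup>2)\<close>. Writing \<open>y = D \<zeta>\<close>
  and \<open>\<theta> = \<zeta>'\<close>, one has \<open>(D\<^sup>2 \<theta>)' = - \<tau> D\<^sup>2 \<zeta>\<close>, which is stable when integrated from
  right to left. The solutions with \<open>\<zeta> = 1\<close>, \<open>\<theta> = 0\<close> at \<open>x = n\<close> therefore converge, locally uniformly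
  in \<open>\<lambda>\<close>, to the recessive solution. Uniqueness follows from the constancy of the Wronskian, and
  \<open>-\<infinity>\<close> is reduced to \<open>+\<infinity>\<close> by reflection.

  For two square-integrable solutions \<open>f\<close>, \<open>g\<close> the functions \<open>Re (f' f\<^sup>*)\<close>, \<open>Re (g' g\<^sup>*)\<close> are eventually
  increasing and nonpositive, and their increments over unit intervals bound the constant
  Wronskian, which is therefore zero.
\<close>

subsection \<open>Linear systems with an entire parameter\<close>

text \<open>With \<open>Aplus\<close> itself as comparison function, \<open>q\<close> stays in the
  residual; backward integration then gives only \<open>\<theta> = O(1/x)\<close>, whose integral
  diverges logarithmically. Boundedness of \<open>q\<close> alone cannot yield the asymptotics (a
  nonzero constant \<open>q\<close> shifts \<open>lam\<close> and changes the power of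
  \<open>x\<close>), so \<open>q1\<close> has to enter through the exponent \<open>W\<close>. The
  second obstacle is that \<open>q\<close> is only measurable: \<open>y'\<close> need not be
  differentiable everywhere, so derivatives are taken of combinations in which \<open>q\<close> has
  cancelled, namely \<open>y' - q1 y\<close>, \<open>w - q1\<close> and \<open>y' - p y\<close>.
  Starting from data at finite points \<open>n\<close>, rather than from an integral equation on a
  half-line, makes every approximant an entire combination of two fixed solutions, so only the
  convergence of two coefficient sequences is at stake.\<close>

lemma vector_derivative_zero_imp_const:
  fixes f :: "real \<Rightarrow> complex"
  assumes "\<And>x. (f has_vector_derivative 0) (at x)"
  shows "f x = f y"
proof -
  obtain c where "\<And>x. x \<in> UNIV \<Longrightarrow> f x = c"
    using has_vector_derivative_zero_constant[of UNIV f] assms by auto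
  then show ?thesis by auto
qed

section \<open>Oriented antiderivatives of continuous functions\<close>

definition antideriv :: "(real \<Rightarrow> complex) \<Rightarrow> real \<Rightarrow> complex" where
  "antideriv f x = (LBINT t=0..x. f t)"

lemma antideriv_0 [simp]: "antideriv f 0 = 0"
  by (simp add: antideriv_def zero_ereal_def)

lemma antideriv_has_vector_derivative:
  assumes "continuous_on UNIV f"
  shows "(antideriv f has_vector_derivative f x) (at x)"
proof -
  define a where "a = \<bar>x\<bar> + 1"
  have "((\<lambda>u. LBINT y=0..u. f y) has_vector_derivative f x) (at x within {-a..a})"
    unfolding zero_ereal_def
    by (rule interval_integral_FTC2) (use assms in \<open>auto simp: a_def intro: continuous_on_subset\<close>)
  then have "(antideriv f has_vector_derivative f x) (at x within {-a..a})"
    by (simp add: antideriv_def[abs_def])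
  moreover have "x \<in> interior {-a..a}"
    by (auto simp: a_def)
  ultimately show ?thesis
    by (metis at_within_interior)
qed

text \<open>Stands in for linearity of the integral: identities between antiderivatives are checked
  by differentiating both sides and comparing at 0.\<close>

lemma antideriv_unique:
  assumes "continuous_on UNIV f" "F 0 = 0" "\<And>x. (F has_vector_derivative f x) (at x)"
  shows "antideriv f = F"
proof
  fix x
  have "((\<lambda>x. antideriv f x - F x) has_vector_derivative 0) (at x)" for x
    using has_vector_derivative_diff[OF antideriv_has_vector_derivative[OF assms(1), of x] assms(3)[of x]] by simp
  from vector_derivative_zero_imp_const[OF this, of x 0] assms(2)
  show "antideriv f x = F x" by simp
qed

lemma continuous_on_antideriv:
  "continuous_on UNIV f \<Longrightarrow> continuous_on UNIV (antideriv f)"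
  by (meson antideriv_has_vector_derivative continuous_at_imp_continuous_on has_vector_derivative_continuous)

text \<open>Each integration gains a factor \<open>|x| / (k + 1)\<close>, the source of the
  factorial in the Picard bounds. Only \<open>|t| \<le> N\<close> is considered because the
  coefficients of the system are merely locally bounded.\<close>

lemma antideriv_power_bound:
  assumes f: "continuous_on UNIV f"
    and b: "\<And>t. \<bar>t\<bar> \<le> N \<Longrightarrow> norm (f t) \<le> C * \<bar>t\<bar> ^ k"
    and x: "\<bar>x\<bar> \<le> N"
  shows "norm (antideriv f x) \<le> C * \<bar>x\<bar> ^ Suc k / real (Suc k)"
proof -
  have gen: "norm (F y) \<le> C * y ^ Suc k / real (Suc k)"
    if F: "\<And>t. (F has_vector_derivative f' t) (at t)" "F 0 = 0"
      and f': "\<And>t. 0 < t \<Longrightarrow> t \<le> y \<Longrightarrow> norm (f' t) \<le> C * t ^ k" and "0 < y"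
    for F f' :: "real \<Rightarrow> complex" and y
  proof -
    have "norm (F y - F 0) \<le> C * y ^ Suc k / real (Suc k) - C * 0 ^ Suc k / real (Suc k)"
    proof (rule differentiable_bound_general[OF \<open>0 < y\<close>])
      show "continuous_on {0..y} F"
        by (meson F(1) continuous_at_imp_continuous_on has_vector_derivative_continuous)
      show "continuous_on {0..y} (\<lambda>y. C * y ^ Suc k / real (Suc k))"
        by (intro continuous_intros) auto
      show "((\<lambda>y. C * y ^ Suc k / real (Suc k)) has_vector_derivative C * t ^ k) (at t)" for t
        unfolding has_real_derivative_iff_has_vector_derivative[symmetric]
        by (rule derivative_eq_intros refl | simp del: of_nat_Suc)+
      show "(F has_vector_derivative f' t) (at t)" for t by (rule F)
      show "norm (f' t) \<le> C * t ^ k" if "0 < t" "t < y" for t using f' that by auto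
    qed
    with F(2) show ?thesis by simp
  qed
  consider "x = 0" | "x > 0" | "x < 0" by linarith
  then show ?thesis
  proof cases
    case 2
    have "norm (antideriv f x) \<le> C * x ^ Suc k / real (Suc k)"
    proof (rule gen[OF antideriv_has_vector_derivative[OF f]])
      show "norm (f t) \<le> C * t ^ k" if "0 < t" "t \<le> x" for t
        using b[of t] x that by auto
    qed (use 2 in auto)
    with 2 show ?thesis by simp
  next
    case 3
    have "((\<lambda>t. antideriv f (- t)) has_vector_derivative - f (- t)) (at t)" for t
    proof -
      have "(uminus has_vector_derivative - 1) (at t)"
        by (auto intro!: derivative_eq_intros)
      from vector_diff_chain_at[OF this antideriv_has_vector_derivative[OF f, of "-t"]]
      show ?thesis by (simp add: o_def)
    qed
    moreover have "norm (- f (- t)) \<le> C * t ^ k" if "0 < t" "t \<le> - x" for t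
      using b[of "-t"] that x by auto
    ultimately have "norm (antideriv f (- (- x))) \<le> C * (- x) ^ Suc k / real (Suc k)"
      using 3 by (intro gen) auto
    with 3 show ?thesis by simp
  qed auto
qed

text \<open>The functions polynomial in \<open>lam\<close> with coefficients continuous in
  \<open>x\<close>. Closure of this class under antiderivatives makes the Picard terms holomorphic
  in \<open>lam\<close> without differentiating under an integral.\<close>

inductive param_poly :: "(real \<Rightarrow> complex \<Rightarrow> complex) \<Rightarrow> bool" where
  const: "continuous_on UNIV c \<Longrightarrow> param_poly (\<lambda>x lam. c x)"
| times: "param_poly f \<Longrightarrow> param_poly (\<lambda>x lam. lam * f x lam)"
| add: "param_poly f \<Longrightarrow> param_poly g \<Longrightarrow> param_poly (\<lambda>x lam. f x lam + g x lam)"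

lemma param_poly_continuous:
  "param_poly f \<Longrightarrow> continuous_on UNIV (\<lambda>x. f x lam)"
  by (induction rule: param_poly.induct) (auto intro: continuous_intros)

lemma param_poly_holomorphic:
  "param_poly f \<Longrightarrow> f x holomorphic_on UNIV"
  by (induction rule: param_poly.induct) (auto intro: holomorphic_intros)

lemma param_poly_mult:
  assumes "param_poly f" and c: "continuous_on UNIV c"
  shows "param_poly (\<lambda>x lam. c x * f x lam)"
  using assms(1)
proof induction
  case (const d)
  then show ?case using c by (auto intro!: param_poly.const continuous_intros)
next
  case (times f)
  from param_poly.times[OF times.IH] show ?case by (simp add: mult.left_commute)
next
  case (add f g)
  from param_poly.add[OF add.IH] show ?case by (simp add: algebra_simps)
qed

lemma param_poly_antideriv:
  assumes "param_poly f"
  shows "param_poly (\<lambda>x lam. antideriv (\<lambda>x. f x lam) x)"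
  using assms
proof induction
  case (const d)
  then show ?case by (auto intro!: param_poly.const continuous_on_antideriv)
next
  case (times f)
  have c: "continuous_on UNIV (\<lambda>x. f x lam)" for lam
    by (rule param_poly_continuous[OF times.hyps])
  have "antideriv (\<lambda>x. lam * f x lam) = (\<lambda>x. lam * antideriv (\<lambda>x. f x lam) x)" for lam
    by (intro antideriv_unique)
      (auto intro!: continuous_intros c has_vector_derivative_mult_right antideriv_has_vector_derivative)
  with param_poly.times[OF times.IH] show ?case by simp
next
  case (add f g)
  have c: "continuous_on UNIV (\<lambda>x. f x lam)" "continuous_on UNIV (\<lambda>x. g x lam)" for lam
    by (rule param_poly_continuous[OF add.hyps(1)], rule param_poly_continuous[OF add.hyps(2)])
  have "antideriv (\<lambda>x. f x lam + g x lam) = (\<lambda>x. antideriv (\<lambda>x. f x lam) x + antideriv (\<lambda>x. g x lam) x)" for lam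
    by (intro antideriv_unique)
      (auto intro!: continuous_intros c has_vector_derivative_add
        antideriv_has_vector_derivative)
  with param_poly.add[OF add.IH] show ?case by simp
qed

text \<open>Terms, not partial sums, of the Picard series for \<open>u' = p u + v\<close>,
  \<open>v' = (r - lam) u - p v\<close>: each term integrates the right-hand side evaluated at its
  predecessor.\<close>

fun picard_term :: "(real \<Rightarrow> complex) \<Rightarrow> (real \<Rightarrow> complex) \<Rightarrow> complex \<Rightarrow> complex \<Rightarrow> nat \<Rightarrow>
    (real \<Rightarrow> complex \<Rightarrow> complex) \<times> (real \<Rightarrow> complex \<Rightarrow> complex)" where
  "picard_term p r u0 v0 0 = (\<lambda>x lam. u0, \<lambda>x lam. v0)"
| "picard_term p r u0 v0 (Suc k) =
    (let (a, b) = picard_term p r u0 v0 k in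
      (\<lambda>x lam. antideriv (\<lambda>t. p t * a t lam + b t lam) x,
       \<lambda>x lam. antideriv (\<lambda>t. (r t - lam) * a t lam - p t * b t lam) x))"

lemma uniform_limit_sections:
  assumes "uniform_limit (A \<times> B) (\<lambda>n (x, y). f n x y) (\<lambda>(x, y). g x y) F"
  shows "x \<in> A \<Longrightarrow> uniform_limit B (\<lambda>n y. f n x y) (\<lambda>y. g x y) F"
    and "y \<in> B \<Longrightarrow> uniform_limit A (\<lambda>n x. f n x y) (\<lambda>x. g x y) F"
  using assms unfolding uniform_limit_iff by (fastforce elim!: eventually_mono)+

lemma holomorphic_sequence_locally_uniform:
  assumes "\<And>n. f n holomorphic_on UNIV"
    and "\<And>R. R > 0 \<Longrightarrow> uniform_limit (cball 0 R) f g sequentially"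
  shows "g holomorphic_on (UNIV :: complex set)"
proof (rule holomorphic_uniform_sequence[OF open_UNIV assms(1)])
  fix z :: complex
  have "norm w \<le> norm z + 1" if "norm (z - w) \<le> 1" for w
    using norm_triangle_sub[of w z] that by (simp add: norm_minus_commute)
  then have "uniform_limit (cball z 1) f g sequentially"
    by (intro uniform_limit_on_subset[OF assms(2)[of "norm z + 1"]]) (auto simp: dist_norm add_nonneg_pos)
  then show "\<exists>d>0. cball z d \<subseteq> UNIV \<and> uniform_limit (cball z d) f g sequentially"
    by (intro exI[of _ 1]) auto
qed

text \<open>The Picard series is dominated by an exponential series, locally uniformly in
  \<open>(x, lam)\<close>. The differential equations come from the limit of the integral equations
  of the partial sums, so nothing is differentiated termwise.\<close>

lemma linear_system_entire:
  fixes p r :: "real \<Rightarrow> complex" and u0 v0 :: complex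
  assumes p: "continuous_on UNIV p" and r: "continuous_on UNIV r"
  obtains u v :: "real \<Rightarrow> complex \<Rightarrow> complex"
  where "\<And>lam. u 0 lam = u0" "\<And>lam. v 0 lam = v0"
    and "\<And>x lam. ((\<lambda>x. u x lam) has_vector_derivative p x * u x lam + v x lam) (at x)"
    and "\<And>x lam. ((\<lambda>x. v x lam) has_vector_derivative (r x - lam) * u x lam - p x * v x lam) (at x)"
    and "\<And>x. u x holomorphic_on UNIV" "\<And>x. v x holomorphic_on UNIV"
proof -
  define a where "a k = fst (picard_term p r u0 v0 k)" for k
  define b where "b k = snd (picard_term p r u0 v0 k)" for k
  have a0: "a 0 x lam = u0" and b0: "b 0 x lam = v0" for x lam by (auto simp: a_def b_def)
  have aS: "a (Suc k) = (\<lambda>x lam. antideriv (\<lambda>t. p t * a k t lam + b k t lam) x)" for k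
    by (simp add: a_def b_def split: prod.split)
  have bS: "b (Suc k) = (\<lambda>x lam. antideriv (\<lambda>t. (r t - lam) * a k t lam - p t * b k t lam) x)" for k
    by (simp add: a_def b_def split: prod.split)
  have neg: "continuous_on UNIV (\<lambda>t. - p t)" using p by (intro continuous_intros)
  have poly1: "param_poly (\<lambda>t lam. p t * f t lam + g t lam)"
    and poly2: "param_poly (\<lambda>t lam. (r t - lam) * f t lam - p t * g t lam)"
    if "param_poly f" "param_poly g" for f g
  proof -
    show "param_poly (\<lambda>t lam. p t * f t lam + g t lam)"
      by (intro param_poly.add param_poly_mult that p)
    have "param_poly (\<lambda>t lam. (r t * f t lam + (-1) * (lam * f t lam)) + (- p t) * g t lam)"
      by (intro param_poly.add param_poly_mult param_poly.times that r neg continuous_intros)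
    then show "param_poly (\<lambda>t lam. (r t - lam) * f t lam - p t * g t lam)"
      by (simp add: algebra_simps)
  qed
  have poly: "param_poly (a k) \<and> param_poly (b k)" for k
  proof (induction k)
    case 0
    show ?case unfolding a_def b_def by (auto intro: param_poly.const continuous_intros)
  next
    case (Suc k)
    then show ?case
      unfolding aS bS by (intro conjI param_poly_antideriv poly1 poly2) auto
  qed
  have cont1: "continuous_on UNIV (\<lambda>t. p t * a k t lam + b k t lam)"
    and cont2: "continuous_on UNIV (\<lambda>t. (r t - lam) * a k t lam - p t * b k t lam)" for k lam
    using poly[of k] poly1 poly2 by (auto intro: param_poly_continuous)
  have bound: "\<exists>M. summable M \<and> (\<forall>k x lam. \<bar>x\<bar> \<le> N \<and> norm lam \<le> R \<longrightarrow> norm (a k x lam) \<le> M k \<and> norm (b k x lam) \<le> M k)"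
    if "N \<ge> 0" "R \<ge> 0" for N R
  proof -
    have "bounded (p ` {-N..N})" "bounded (r ` {-N..N})"
      by (intro compact_imp_bounded compact_continuous_image continuous_on_subset[OF p]
          continuous_on_subset[OF r]; simp)+
    then obtain P Q where "\<forall>x\<in>{-N..N}. norm (p x) \<le> P" "\<forall>x\<in>{-N..N}. norm (r x) \<le> Q"
      unfolding bounded_iff by blast
    then have PQ: "\<And>x. \<bar>x\<bar> \<le> N \<Longrightarrow> norm (p x) \<le> P" "\<And>x. \<bar>x\<bar> \<le> N \<Longrightarrow> norm (r x) \<le> Q"
      by (auto simp: abs_le_iff)
    have P0: "P \<ge> 0" and Q0: "Q \<ge> 0" using PQ[of 0] \<open>N \<ge> 0\<close> norm_ge_zero order_trans by (auto, blast+)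
    \<comment> \<open>\<open>L\<close> dominates the coefficients of either row of the system:
      \<open>P + 1\<close> in the first, \<open>Q + R + P\<close> in the second. \<open>K\<close>
      bounds the initial data.\<close>
    define L where "L = P + Q + R + 1"
    define K where "K = norm u0 + norm v0"
    have L0: "L \<ge> 0" and K0: "K \<ge> 0" using P0 Q0 that by (auto simp: L_def K_def)
    have main: "norm (a k x lam) \<le> K * (L ^ k / fact k) * \<bar>x\<bar> ^ k \<and> norm (b k x lam) \<le> K * (L ^ k / fact k) * \<bar>x\<bar> ^ k"
      if "\<bar>x\<bar> \<le> N" "norm lam \<le> R" for k x lam
      using that(1)
    proof (induction k arbitrary: x)
      case 0
      show ?case by (simp add: a0 b0 K_def)
    next
      case (Suc k)
      define B where "B = K * (L ^ k / fact k)"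
      have B: "norm (a k t lam) \<le> B * \<bar>t\<bar> ^ k" "norm (b k t lam) \<le> B * \<bar>t\<bar> ^ k" "0 \<le> B * \<bar>t\<bar> ^ k"
        if "\<bar>t\<bar> \<le> N" for t
        using Suc.IH[OF that] L0 K0 by (auto simp: B_def)
      have t1: "norm (p t * a k t lam + b k t lam) \<le> (L * B) * \<bar>t\<bar> ^ k" if t: "\<bar>t\<bar> \<le> N" for t
      proof -
        have "norm (p t * a k t lam + b k t lam) \<le> P * (B * \<bar>t\<bar> ^ k) + B * \<bar>t\<bar> ^ k"
          by (rule order_trans[OF norm_triangle_ineq])
            (auto simp: norm_mult intro!: add_mono mult_mono PQ B t P0)
        also have "\<dots> \<le> L * (B * \<bar>t\<bar> ^ k)"
          using mult_right_mono[of "P + 1" L, OF _ B(3)[OF t]] Q0 \<open>R \<ge> 0\<close> by (simp add: L_def algebra_simps)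
        finally show ?thesis by (simp add: mult_ac)
      qed
      have t2: "norm ((r t - lam) * a k t lam - p t * b k t lam) \<le> (L * B) * \<bar>t\<bar> ^ k" if t: "\<bar>t\<bar> \<le> N" for t
      proof -
        have "norm (r t - lam) \<le> Q + R"
          using norm_triangle_ineq4[of "r t" lam] PQ(2)[OF t] \<open>norm lam \<le> R\<close> by linarith
        then have "norm ((r t - lam) * a k t lam - p t * b k t lam) \<le> (Q + R) * (B * \<bar>t\<bar> ^ k) + P * (B * \<bar>t\<bar> ^ k)"
          by (intro order_trans[OF norm_triangle_ineq4])
            (auto simp: norm_mult intro!: add_mono mult_mono PQ B t P0 Q0 \<open>R \<ge> 0\<close> add_nonneg_nonneg)
        also have "\<dots> \<le> L * (B * \<bar>t\<bar> ^ k)"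
          using mult_right_mono[of "Q + R + P" L, OF _ B(3)[OF t]] by (simp add: L_def algebra_simps)
        finally show ?thesis by (simp add: mult_ac)
      qed
      have e: "(L * B) * \<bar>x\<bar> ^ Suc k / real (Suc k) = K * (L ^ Suc k / fact (Suc k)) * \<bar>x\<bar> ^ Suc k"
        by (simp add: B_def field_simps)
      show ?case
        using antideriv_power_bound[OF cont1 t1 Suc.prems] antideriv_power_bound[OF cont2 t2 Suc.prems]
        unfolding e aS bS by blast
    qed
    have "summable (\<lambda>k. K * ((L * N) ^ k / fact k))"
      using summable_exp_generic[of "L * N"] by (intro summable_mult) (simp add: divide_inverse mult_ac)
    moreover have "K * (L ^ k / fact k) * \<bar>x\<bar> ^ k \<le> K * ((L * N) ^ k / fact k)" if "\<bar>x\<bar> \<le> N" for k x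
    proof -
      have "K * (L ^ k / fact k) * \<bar>x\<bar> ^ k \<le> K * (L ^ k / fact k) * N ^ k"
        by (intro mult_left_mono power_mono that) (use K0 L0 in auto)
      then show ?thesis by (simp add: power_mult_distrib)
    qed
    ultimately show ?thesis using main by (intro exI[of _ "\<lambda>k. K * ((L * N) ^ k / fact k)"]) (meson order_trans)
  qed
  define u where "u x lam = (\<Sum>k. a k x lam)" for x lam
  define v where "v x lam = (\<Sum>k. b k x lam)" for x lam
  define S where "S n x lam = (\<Sum>k<n. a k x lam)" for n x lam
  define T where "T n x lam = (\<Sum>k<n. b k x lam)" for n x lam
  have unif: "uniform_limit ({-N..N} \<times> cball 0 R) (\<lambda>n (x, lam). S n x lam) (\<lambda>(x, lam). u x lam) sequentially"
             "uniform_limit ({-N..N} \<times> cball 0 R) (\<lambda>n (x, lam). T n x lam) (\<lambda>(x, lam). v x lam) sequentially"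
    if NR: "N \<ge> 0" "R \<ge> 0" for N R
  proof -
    obtain M where M: "summable M" "\<And>k x lam. \<bar>x\<bar> \<le> N \<Longrightarrow> norm lam \<le> R \<Longrightarrow> norm (a k x lam) \<le> M k \<and> norm (b k x lam) \<le> M k"
      using bound[OF NR] by blast
    show "uniform_limit ({-N..N} \<times> cball 0 R) (\<lambda>n (x, lam). S n x lam) (\<lambda>(x, lam). u x lam) sequentially"
      using Weierstrass_m_test[OF _ M(1), of "{-N..N} \<times> cball 0 R" "\<lambda>k (x, lam). a k x lam"] M(2)
      by (auto simp: S_def u_def case_prod_unfold abs_le_iff)
    show "uniform_limit ({-N..N} \<times> cball 0 R) (\<lambda>n (x, lam). T n x lam) (\<lambda>(x, lam). v x lam) sequentially"
      using Weierstrass_m_test[OF _ M(1), of "{-N..N} \<times> cball 0 R" "\<lambda>k (x, lam). b k x lam"] M(2)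
      by (auto simp: T_def v_def case_prod_unfold abs_le_iff)
  qed
  have lamlim: "uniform_limit (cball 0 R) (\<lambda>n lam. S n x lam) (u x) sequentially"
               "uniform_limit (cball 0 R) (\<lambda>n lam. T n x lam) (v x) sequentially" if "R > 0" for x R
  proof -
    have x: "x \<in> {-\<bar>x\<bar>..\<bar>x\<bar>}" by (auto simp: abs_if)
    show "uniform_limit (cball 0 R) (\<lambda>n lam. S n x lam) (u x) sequentially"
         "uniform_limit (cball 0 R) (\<lambda>n lam. T n x lam) (v x) sequentially"
      using uniform_limit_sections(1)[OF unif(1)[of "\<bar>x\<bar>" R] x]
        uniform_limit_sections(1)[OF unif(2)[of "\<bar>x\<bar>" R] x] that by auto
  qed
  have xlim: "uniform_limit {-N..N} (\<lambda>n x. S n x lam) (\<lambda>x. u x lam) sequentially"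
             "uniform_limit {-N..N} (\<lambda>n x. T n x lam) (\<lambda>x. v x lam) sequentially" if "N \<ge> 0" for lam N
    using uniform_limit_sections(2)[OF unif(1)[of N "norm lam"], of lam]
      uniform_limit_sections(2)[OF unif(2)[of N "norm lam"], of lam] that by auto
  have Scont: "continuous_on UNIV (\<lambda>x. S n x lam)" and Tcont: "continuous_on UNIV (\<lambda>x. T n x lam)" for n lam
    unfolding S_def T_def
    by (intro continuous_intros param_poly_continuous poly[THEN conjunct1] poly[THEN conjunct2])+
  have contU: "continuous_on UNIV f" if "\<And>N. N \<ge> (0::real) \<Longrightarrow> continuous_on {-N..N} f" for f :: "real \<Rightarrow> complex"
  proof -
    have "isCont f x" for x
    proof -
      have "x \<in> {-\<bar>x\<bar> - 1..\<bar>x\<bar> + 1}" by (auto simp: abs_if)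
      then have "continuous (at x within {-\<bar>x\<bar> - 1..\<bar>x\<bar> + 1}) f"
        using that[of "\<bar>x\<bar> + 1"] by (simp add: continuous_on_eq_continuous_within)
      moreover have "x \<in> interior {-\<bar>x\<bar> - 1..\<bar>x\<bar> + 1}" by (auto simp: abs_if)
      ultimately show ?thesis by (metis at_within_interior)
    qed
    then show ?thesis by (simp add: continuous_at_imp_continuous_on)
  qed
  have ucont: "continuous_on UNIV (\<lambda>x. u x lam)" for lam
    by (rule contU, rule uniform_limit_theorem[OF _ xlim(1)])
      (auto intro!: always_eventually continuous_on_subset[OF Scont])
  have vcont: "continuous_on UNIV (\<lambda>x. v x lam)" for lam
    by (rule contU, rule uniform_limit_theorem[OF _ xlim(2)])
      (auto intro!: always_eventually continuous_on_subset[OF Tcont])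
  \<comment> \<open>Passage to the limit in the integral equation, stated abstractly to serve both
    components: partial sum \<open>n + 1\<close> is the initial value plus the antiderivative of an
    expression in partial sum \<open>n\<close>.\<close>
  have lim_eq: "F x = z0 + antideriv f x"
    if fcont: "continuous_on UNIV f" and fncont: "\<And>n. continuous_on UNIV (fn n)"
      and ul: "uniform_limit {-\<bar>x\<bar>..\<bar>x\<bar>} fn f sequentially"
      and Fn: "\<And>n. Fn (Suc n) = z0 + antideriv (fn n) x" and Flim: "Fn \<longlonglongrightarrow> F x"
    for F f fn Fn z0 and x :: real
  proof -
    have "(\<lambda>n. antideriv (fn n) x) \<longlonglongrightarrow> antideriv f x"
    proof (rule LIMSEQ_I)
      fix e :: real assume e: "e > 0"
      define d where "d = e / (\<bar>x\<bar> + 1)"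
      have d: "d > 0" using e by (simp add: d_def)
      obtain n0 where n0': "\<forall>n\<ge>n0. \<forall>t\<in>{-\<bar>x\<bar>..\<bar>x\<bar>}. dist (fn n t) (f t) < d"
        using ul d unfolding uniform_limit_sequentially_iff by blast
      have n0: "norm (fn n t - f t) < d" if "n \<ge> n0" "\<bar>t\<bar> \<le> \<bar>x\<bar>" for n t
      proof -
        have "t \<in> {-\<bar>x\<bar>..\<bar>x\<bar>}" using abs_le_D1[OF that(2)] abs_le_D2[OF that(2)] by (simp add: minus_le_iff)
        with n0' that(1) show ?thesis by (simp add: dist_norm)
      qed
      have "norm (antideriv (fn n) x - antideriv f x) < e" if "n \<ge> n0" for n
      proof -
        have c: "continuous_on UNIV (\<lambda>t. fn n t - f t)" by (intro continuous_intros fcont fncont)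
        have "antideriv (\<lambda>t. fn n t - f t) = (\<lambda>x. antideriv (fn n) x - antideriv f x)"
          by (rule antideriv_unique[OF c])
            (auto intro!: has_vector_derivative_diff antideriv_has_vector_derivative fcont fncont)
        then have "norm (antideriv (fn n) x - antideriv f x) \<le> d * \<bar>x\<bar>"
          using antideriv_power_bound[OF c, of "\<bar>x\<bar>" d 0 x] n0[OF that] by (simp add: less_imp_le)
        also have "\<dots> < e" using e by (simp add: d_def field_simps)
        finally show ?thesis .
      qed
      then show "\<exists>no. \<forall>n\<ge>no. norm (antideriv (fn n) x - antideriv f x) < e" by blast
    qed
    then have "(\<lambda>n. Fn (Suc n)) \<longlonglongrightarrow> z0 + antideriv f x"
      unfolding Fn by (intro tendsto_intros)
    with Flim show ?thesis by (metis LIMSEQ_Suc LIMSEQ_unique)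
  qed
  have bdd: "bounded (f ` {-N..N})" if "continuous_on UNIV f" for f :: "real \<Rightarrow> complex" and N :: real
    by (intro compact_imp_bounded compact_continuous_image continuous_on_subset[OF that]) auto
  have pu: "uniform_limit {-N..N} (\<lambda>n x. p x * S n x lam + T n x lam) (\<lambda>x. p x * u x lam + v x lam) sequentially"
    if "N \<ge> 0" for N lam
    by (intro uniform_limit_add uniform_lim_mult uniform_limit_const xlim that bdd p ucont)
  have pv: "uniform_limit {-N..N} (\<lambda>n x. (r x - lam) * S n x lam - p x * T n x lam)
       (\<lambda>x. (r x - lam) * u x lam - p x * v x lam) sequentially"
    if "N \<ge> 0" for N lam
    by (intro uniform_limit_minus uniform_lim_mult uniform_limit_const xlim that bdd p r ucont vcont continuous_intros)
  have SS: "S (Suc n) x lam = u0 + antideriv (\<lambda>t. p t * S n t lam + T n t lam) x" for n x lam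
  proof (induction n)
    case 0
    show ?case using antideriv_unique[of "\<lambda>_. 0" "\<lambda>_. 0"] by (simp add: S_def T_def a0)
  next
    case (Suc n)
    have "antideriv (\<lambda>t. (p t * S n t lam + T n t lam) + (p t * a n t lam + b n t lam)) =
       (\<lambda>x. antideriv (\<lambda>t. p t * S n t lam + T n t lam) x + antideriv (\<lambda>t. p t * a n t lam + b n t lam) x)"
      by (rule antideriv_unique)
        (auto intro!: continuous_intros has_vector_derivative_add antideriv_has_vector_derivative cont1 p Scont Tcont poly[THEN conjunct1, THEN param_poly_continuous] poly[THEN conjunct2, THEN param_poly_continuous])
    moreover have "S (Suc (Suc n)) x lam = S (Suc n) x lam + antideriv (\<lambda>t. p t * a n t lam + b n t lam) x"
      unfolding S_def by (subst sum.lessThan_Suc) (simp add: aS)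
    moreover have "(\<lambda>t. p t * S (Suc n) t lam + T (Suc n) t lam) =
       (\<lambda>t. (p t * S n t lam + T n t lam) + (p t * a n t lam + b n t lam))"
      by (auto simp: S_def T_def algebra_simps)
    ultimately show ?case using Suc by simp
  qed
  have TT: "T (Suc n) x lam = v0 + antideriv (\<lambda>t. (r t - lam) * S n t lam - p t * T n t lam) x" for n x lam
  proof (induction n)
    case 0
    show ?case using antideriv_unique[of "\<lambda>_. 0" "\<lambda>_. 0"] by (simp add: S_def T_def b0)
  next
    case (Suc n)
    have "antideriv (\<lambda>t. ((r t - lam) * S n t lam - p t * T n t lam) + ((r t - lam) * a n t lam - p t * b n t lam)) =
       (\<lambda>x. antideriv (\<lambda>t. (r t - lam) * S n t lam - p t * T n t lam) x + antideriv (\<lambda>t. (r t - lam) * a n t lam - p t * b n t lam) x)"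
      by (rule antideriv_unique)
        (auto intro!: continuous_intros has_vector_derivative_add antideriv_has_vector_derivative cont2 p r Scont Tcont poly[THEN conjunct1, THEN param_poly_continuous] poly[THEN conjunct2, THEN param_poly_continuous])
    moreover have "T (Suc (Suc n)) x lam = T (Suc n) x lam + antideriv (\<lambda>t. (r t - lam) * a n t lam - p t * b n t lam) x"
      unfolding T_def by (subst sum.lessThan_Suc) (simp add: bS)
    moreover have "(\<lambda>t. (r t - lam) * S (Suc n) t lam - p t * T (Suc n) t lam) =
       (\<lambda>t. ((r t - lam) * S n t lam - p t * T n t lam) + ((r t - lam) * a n t lam - p t * b n t lam))"
      by (auto simp: S_def T_def algebra_simps)
    ultimately show ?case using Suc by simp
  qed
  have cu: "continuous_on UNIV (\<lambda>x. p x * u x lam + v x lam)" for lam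
    by (intro continuous_intros p ucont vcont)
  have cv: "continuous_on UNIV (\<lambda>x. (r x - lam) * u x lam - p x * v x lam)" for lam
    by (intro continuous_intros p r ucont vcont)
  have ueq: "u x lam = u0 + antideriv (\<lambda>x. p x * u x lam + v x lam) x" for x lam
    by (rule lim_eq[where Fn = "\<lambda>n. S n x lam", OF cu _ pu SS])
       (auto intro!: continuous_intros p Scont Tcont tendsto_uniform_limitI[OF xlim(1)[of "\<bar>x\<bar>"]])
  have veq: "v x lam = v0 + antideriv (\<lambda>x. (r x - lam) * u x lam - p x * v x lam) x" for x lam
    by (rule lim_eq[where Fn = "\<lambda>n. T n x lam", OF cv _ pv TT])
       (auto intro!: continuous_intros p r Scont Tcont tendsto_uniform_limitI[OF xlim(2)[of "\<bar>x\<bar>"]])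
  show ?thesis
  proof (rule that[of u v])
    show "u 0 lam = u0" "v 0 lam = v0" for lam using ueq[of 0 lam] veq[of 0 lam] by auto
    show "((\<lambda>x. u x lam) has_vector_derivative p x * u x lam + v x lam) (at x)" for x lam
      by (subst ueq) (auto intro!: derivative_eq_intros antideriv_has_vector_derivative[OF cu])
    show "((\<lambda>x. v x lam) has_vector_derivative (r x - lam) * u x lam - p x * v x lam) (at x)" for x lam
      by (subst veq) (auto intro!: derivative_eq_intros antideriv_has_vector_derivative[OF cv])
    have ST: "S n x holomorphic_on UNIV" "T n x holomorphic_on UNIV" for n x
      unfolding S_def T_def using poly param_poly_holomorphic by (auto intro!: holomorphic_intros)
    show "u x holomorphic_on UNIV" "v x holomorphic_on UNIV" for x
      by (rule holomorphic_sequence_locally_uniform[OF ST(1) lamlim(1)], assumption,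
          rule holomorphic_sequence_locally_uniform[OF ST(2) lamlim(2)], assumption)
  qed
qed

subsection \<open>The quasi-derivative and the Wronskian\<close>

text \<open>Integration by parts where \<open>F\<close> is an indefinite integral of a merely
  bounded measurable \<open>\<phi>\<close>, so \<open>F * G\<close> may fail to be differentiable.
  Subtracting the indefinite integral \<open>H\<close> of \<open>\<phi> * G\<close> repairs this:
  \<open>F * G - H\<close> has derivative \<open>F * G'\<close> at every point, and the fundamental
  theorem applies to it.\<close>

lemma has_integral_mult_indefinite:
  fixes \<phi> F G G' :: "real \<Rightarrow> complex"
  assumes ab: "a \<le> b"
    and meas: "\<phi> \<in> borel_measurable borel"
    and bnd: "\<And>t. t \<in> {a..b} \<Longrightarrow> norm (\<phi> t) \<le> K"
    and F: "\<And>x y. a \<le> x \<Longrightarrow> x \<le> y \<Longrightarrow> y \<le> b \<Longrightarrow> (\<phi> has_integral F y - F x) {x..y}"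
    and G: "\<And>t. t \<in> {a..b} \<Longrightarrow> (G has_vector_derivative G' t) (at t within {a..b})"
    and G': "continuous_on {a..b} G'"
  shows "((\<lambda>t. \<phi> t * G t + F t * G' t) has_integral F b * G b - F a * G a) {a..b}"
proof -
  have K: "K \<ge> 0" using bnd[of a] ab norm_ge_zero[of "\<phi> a"] by (auto simp del: norm_ge_zero)
  have Gc: "continuous_on {a..b} G"
    by (meson G continuous_on_vector_derivative)
  have "bounded (G ` {a..b})" by (intro compact_imp_bounded compact_continuous_image Gc compact_Icc)
  then obtain M where M: "\<forall>t\<in>{a..b}. norm (G t) \<le> M" by (auto simp: bounded_iff)
  have "bounded (G' ` {a..b})" by (intro compact_imp_bounded compact_continuous_image G' compact_Icc)
  then obtain L where L: "\<forall>t\<in>{a..b}. norm (G' t) \<le> L" by (auto simp: bounded_iff)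
  have L0: "L \<ge> 0" using bspec[OF L, of a] ab order_trans[OF norm_ge_zero[of "G' a"]] by auto
  have lip: "norm (G x - G y) \<le> L * \<bar>x - y\<bar>" if "x \<in> {a..b}" "y \<in> {a..b}" for x y
  proof -
    have "onorm (\<lambda>h. h *\<^sub>R G' t) = norm (G' t)" for t
      using onorm_scaleR_left[of "\<lambda>h::real. h" "G' t"] onorm_id[where ?'a = real] by simp
    then show ?thesis
      using differentiable_bound[of "{a..b}" G "\<lambda>t h. h *\<^sub>R G' t" L x y] G L that
      by (auto simp: has_vector_derivative_def)
  qed
  have int: "(\<lambda>t. \<phi> t * G t) integrable_on {a..b}"
  proof (rule measurable_bounded_by_integrable_imp_integrable)
    have "\<phi> \<in> borel_measurable (lebesgue_on {a..b})"
      using meas by (intro measurable_restrict_space1 measurable_completion) auto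
    moreover have "G \<in> borel_measurable (lebesgue_on {a..b})"
      by (intro continuous_imp_measurable_on_sets_lebesgue Gc) auto
    ultimately show "(\<lambda>t. \<phi> t * G t) \<in> borel_measurable (lebesgue_on {a..b})" by measurable
    show "(\<lambda>_. K * M) integrable_on {a..b}" by auto
    show "norm (\<phi> t * G t) \<le> K * M" if "t \<in> {a..b}" for t
      using bnd[OF that] M that K by (auto simp: norm_mult intro!: mult_mono)
  qed auto
  define H where "H x = integral {a..x} (\<lambda>t. \<phi> t * G t)" for x
  have H: "((\<lambda>t. \<phi> t * G t) has_integral H y - H x) {x..y}" if "a \<le> x" "x \<le> y" "y \<le> b" for x y
  proof -
    have i: "(\<lambda>t. \<phi> t * G t) integrable_on {u..v}" if "a \<le> u" "v \<le> b" for u v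
      by (rule integrable_on_subinterval[OF int]) (use that in auto)
    have "H x + integral {x..y} (\<lambda>t. \<phi> t * G t) = H y"
      unfolding H_def by (rule Henstock_Kurzweil_Integration.integral_combine) (use that i in auto)
    moreover have "((\<lambda>t. \<phi> t * G t) has_integral integral {x..y} (\<lambda>t. \<phi> t * G t)) {x..y}"
      using i[of x y] that by (intro integrable_integral) auto
    ultimately show ?thesis by (metis add_diff_cancel_left')
  qed
  \<comment> \<open>Freezing \<open>G t\<close> at \<open>G w\<close> costs at most
    \<open>L * (v - u)\<close> by the Lipschitz bound on \<open>G\<close>, hence a quadratic error
    after integration.\<close>
  have quad: "norm ((F v - F u) * G w - (H v - H u)) \<le> K * L * (v - u) * (v - u)"
    if "a \<le> u" "u \<le> v" "v \<le> b" "w \<in> {u..v}" for u v w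
  proof -
    have "((\<lambda>t. \<phi> t * G w - \<phi> t * G t) has_integral (F v - F u) * G w - (H v - H u)) {u..v}"
      by (intro has_integral_diff has_integral_mult_left F H that)
    moreover have "norm (\<phi> t * G w - \<phi> t * G t) \<le> K * L * (v - u)" if t: "t \<in> {u..v}" for t
    proof -
      have "norm (G w - G t) \<le> L * \<bar>w - t\<bar>" using t that \<open>a \<le> u\<close> \<open>v \<le> b\<close> \<open>w \<in> {u..v}\<close> by (intro lip) auto
      also have "\<dots> \<le> L * (v - u)" using t \<open>w \<in> {u..v}\<close> L0 by (intro mult_left_mono) auto
      finally have "norm (\<phi> t) * norm (G w - G t) \<le> K * (L * (v - u))"
        using bnd[of t] t \<open>a \<le> u\<close> \<open>v \<le> b\<close> K by (intro mult_mono) auto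
      moreover have "norm (\<phi> t * G w - \<phi> t * G t) = norm (\<phi> t) * norm (G w - G t)"
        by (simp flip: right_diff_distrib norm_mult)
      ultimately show ?thesis by (simp add: mult_ac)
    qed
    moreover have "0 \<le> K * L * (v - u)" using K L0 that by auto
    ultimately have "norm ((F v - F u) * G w - (H v - H u)) \<le> K * L * (v - u) * Henstock_Kurzweil_Integration.content {u..v}"
      by (intro has_integral_bound_real[OF _ finite.emptyI]) auto
    with that show ?thesis by simp
  qed
  have der: "((\<lambda>y. F y * G y - H y) has_vector_derivative F x * G' x) (at x within {a..b})"
    if x: "x \<in> {a..b}" for x
  proof -
    \<comment> \<open>\<open>F y * G y - H y = F x * G y + Q y - H x\<close>, so only
      \<open>G\<close> and a quadratically small remainder are left to differentiate.\<close>
    define Q where "Q y = (F y - F x) * G y - (H y - H x)" for y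
    have Q: "norm (Q y) \<le> K * L * \<bar>y - x\<bar> * \<bar>y - x\<bar>" if "y \<in> {a..b}" for y
    proof (cases "x \<le> y")
      case True
      then show ?thesis using quad[of x y y] that x by (simp add: Q_def)
    next
      case False
      have "Q y = - ((F x - F y) * G y - (H x - H y))" by (simp add: Q_def algebra_simps)
      then have "norm (Q y) = norm ((F x - F y) * G y - (H x - H y))" by (metis norm_minus_cancel)
      with False show ?thesis using quad[of y x y] that x by simp
    qed
    have "(Q has_vector_derivative 0) (at x within {a..b})"
      unfolding has_vector_derivative_def has_derivative_within_alt
    proof (intro conjI allI impI)
      fix e :: real assume e: "e > 0"
      define d where "d = e / (K * L + 1)"
      have KL: "K * L \<ge> 0" using K L0 by simp
      then have d: "d > 0" and de: "(K * L + 1) * d = e" using e by (auto simp: d_def)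
      show "\<exists>d>0. \<forall>y\<in>{a..b}. norm (y - x) < d \<longrightarrow> norm (Q y - Q x - (y - x) *\<^sub>R 0) \<le> e * norm (y - x)"
      proof (intro exI[of _ d] conjI d ballI impI)
        fix y assume y: "y \<in> {a..b}" "norm (y - x) < d"
        have "K * L * \<bar>y - x\<bar> \<le> (K * L + 1) * d"
          using y(2) KL by (intro mult_mono) auto
        then have "K * L * \<bar>y - x\<bar> * \<bar>y - x\<bar> \<le> e * \<bar>y - x\<bar>"
          using de by (intro mult_right_mono) auto
        with Q[OF y(1)] show "norm (Q y - Q x - (y - x) *\<^sub>R 0) \<le> e * norm (y - x)"
          by (auto simp: Q_def)
      qed
    qed auto
    then have "((\<lambda>y. F x * G y + Q y - H x) has_vector_derivative F x * G' x + 0 - 0) (at x within {a..b})"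
      using G[OF x] by (intro has_vector_derivative_add has_vector_derivative_diff has_vector_derivative_mult_right) auto
    then show ?thesis by (simp add: Q_def algebra_simps)
  qed
  have "((\<lambda>x. F x * G' x) has_integral (F b * G b - H b) - (F a * G a - H a)) {a..b}"
    using ab der by (rule fundamental_theorem_of_calculus)
  with ab have "((\<lambda>t. \<phi> t * G t + F t * G' t) has_integral
      (H b - H a) + ((F b * G b - H b) - (F a * G a - H a))) {a..b}"
    by (intro has_integral_add H) auto
  then show ?thesis by (simp add: algebra_simps)
qed

section \<open>Potentials with \<open>q\<close> and \<open>q1\<close> bounded everywhere, and their
  solutions\<close>

locale bounded_potential =
  fixes q q1 :: "real \<Rightarrow> complex" and C :: real
  assumes q_measurable: "q \<in> borel_measurable borel"
    and q_bound: "norm (q x) \<le> C"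
    and q1_bound: "norm (q1 x) \<le> C"
    and q1_integral: "a \<le> b \<Longrightarrow> (q has_integral (q1 b - q1 a)) {a..b}"
begin

lemma C_nonneg: "C \<ge> 0"
  by (rule order_trans[OF norm_ge_zero q_bound])

lemma q1_lipschitz: "norm (q1 x - q1 y) \<le> C * \<bar>x - y\<bar>"
proof -
  have *: "norm (q1 x - q1 y) \<le> C * (x - y)" if "y \<le> x" for x y
    using has_integral_bound_real[OF C_nonneg finite.emptyI q1_integral[OF that]] q_bound that by auto
  show ?thesis using *[of x y] *[of y x] by (cases "x \<le> y") (auto simp: norm_minus_commute)
qed

lemma q1_continuous: "continuous_on A q1"
proof -
  have "C-lipschitz_on UNIV q1"
    by (rule lipschitz_onI) (use q1_lipschitz C_nonneg in \<open>auto simp: dist_norm dist_real_def\<close>)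
  then show ?thesis by (meson lipschitz_on_continuous_on continuous_on_subset subset_UNIV)
qed

text \<open>An indefinite integral is continuous, even where roughness of \<open>q\<close> prevents
  \<open>y'\<close> from being differentiable. Integration by parts against \<open>q1\<close> asks
  for this continuity.\<close>

lemma is_sol_derivative_continuous:
  assumes "is_sol q lam y y'"
  shows "continuous_on A y'"
proof -
  have "isCont y' x" for x
  proof -
    let ?f = "\<lambda>t. (complex_of_real (t\<^sup>2) + q t - lam) * y t"
    let ?a = "x - 1" and ?b = "x + 1"
    have *: "(?f has_integral (y' b - y' a)) {a..b}" if "a \<le> b" for a b
      using assms that by (simp add: is_sol_def)
    have "continuous_on {?a..?b} (\<lambda>x. integral {?a..x} ?f)"
      by (rule indefinite_integral_continuous_1) (use *[of ?a ?b] in auto)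
    then have "continuous_on {?a..?b} (\<lambda>x. y' ?a + integral {?a..x} ?f)"
      by (intro continuous_intros)
    moreover have "y' ?a + integral {?a..z} ?f = y' z" if "z \<in> {?a..?b}" for z
      using integral_unique[OF *[of ?a z]] that by simp
    ultimately have "continuous_on {?a..?b} y'"
      by (rule continuous_on_eq)
    then have "continuous (at x within {?a..?b}) y'"
      by (simp add: continuous_on_eq_continuous_within)
    moreover have "x \<in> interior {?a..?b}" by simp
    ultimately show ?thesis by (metis at_within_interior)
  qed
  then show ?thesis by (simp add: continuous_at_imp_continuous_on)
qed

lemma is_sol_continuous: "is_sol q lam y y' \<Longrightarrow> continuous_on A y"
  unfolding is_sol_def by (meson continuous_at_imp_continuous_on has_vector_derivative_continuous)

text \<open>The integrated product rule for \<open>q1 y\<close>, with \<open>q\<close> in the role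
  of \<open>q1'\<close>: it trades the rough term \<open>q y\<close> for boundary values and the
  continuous \<open>q1 y'\<close>.\<close>

lemma has_integral_q1_mult:
  assumes "a \<le> b" "\<And>x. (y has_vector_derivative y' x) (at x)" "continuous_on {a..b} y'"
  shows "((\<lambda>t. q t * y t + q1 t * y' t) has_integral q1 b * y b - q1 a * y a) {a..b}"
  by (rule has_integral_mult_indefinite[OF assms(1) q_measurable q_bound q1_integral])
    (use assms in \<open>auto intro: has_vector_derivative_at_within\<close>)

text \<open>The quasi-derivative \<open>y' - q1 y\<close> turns the Caratheodory equation into a first-order system
  with continuous coefficients.\<close>

lemma is_sol_imp_quasi_derivative:
  assumes sol: "is_sol q lam y y'"
  shows "((\<lambda>x. y' x - q1 x * y x) has_vector_derivative
           (complex_of_real (x\<^sup>2) - lam) * y x - q1 x * y' x) (at x)"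
proof -
  let ?f = "\<lambda>t. (complex_of_real (t\<^sup>2) - lam) * y t - q1 t * y' t"
  let ?u = "\<lambda>x. y' x - q1 x * y x"
  let ?a = "x - 1" and ?b = "x + 1"
  have y: "\<And>x. (y has_vector_derivative y' x) (at x)" using sol by (simp add: is_sol_def)
  have *: "(?f has_integral (?u b - ?u a)) {a..b}" if "a \<le> b" for a b
  proof -
    have "((\<lambda>t. (complex_of_real (t\<^sup>2) + q t - lam) * y t) has_integral (y' b - y' a)) {a..b}"
      using sol that by (simp add: is_sol_def)
    \<comment> \<open>Subtracting the product rule removes \<open>q y\<close>; the remaining
      integrand is continuous, which yields a derivative at every point.\<close>
    from has_integral_diff[OF this has_integral_q1_mult[OF that y is_sol_derivative_continuous[OF sol]]]
    show ?thesis by (simp add: algebra_simps)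
  qed
  have "continuous_on {?a..?b} ?f"
    by (intro continuous_intros q1_continuous is_sol_continuous[OF sol] is_sol_derivative_continuous[OF sol])
  then have "((\<lambda>u. integral {?a..u} ?f) has_vector_derivative ?f x) (at x within {?a..?b})"
    by (rule integral_has_vector_derivative) auto
  then have "((\<lambda>u. ?u ?a + integral {?a..u} ?f) has_vector_derivative ?f x) (at x within {?a..?b})"
    by (auto intro!: derivative_eq_intros)
  then have "(?u has_vector_derivative ?f x) (at x within {?a..?b})"
  proof (rule has_vector_derivative_transform[rotated 2])
    show "?u z = ?u ?a + integral {?a..z} ?f" if "z \<in> {?a..?b}" for z
      using integral_unique[OF *[of ?a z]] that by simp
  qed auto
  moreover have "x \<in> interior {?a..?b}" by simp
  ultimately show ?thesis by (metis at_within_interior)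
qed

text \<open>Adding back the integral of \<open>(q1 y)'\<close> restores \<open>q y\<close>, while
  the terms \<open>q1 v\<close> and \<open>q1\<^sup>2 y\<close> cancel.\<close>

lemma is_sol_from_quasi_derivative:
  assumes y: "\<And>x. (y has_vector_derivative q1 x * y x + v x) (at x)"
    and v: "\<And>x. (v has_vector_derivative (complex_of_real (x\<^sup>2) - (q1 x)\<^sup>2 - lam) * y x - q1 x * v x) (at x)"
  shows "is_sol q lam y (\<lambda>x. q1 x * y x + v x)"
  unfolding is_sol_def
proof (intro conjI allI impI y)
  fix a b :: real assume ab: "a \<le> b"
  have c: "continuous_on {a..b} y" "continuous_on {a..b} v"
    by (meson y v continuous_at_imp_continuous_on has_vector_derivative_continuous)+
  have "((\<lambda>t. q t * y t + q1 t * (q1 t * y t + v t)) has_integral q1 b * y b - q1 a * y a) {a..b}"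
    by (intro has_integral_q1_mult ab y continuous_intros c q1_continuous)
  moreover have "((\<lambda>x. (complex_of_real (x\<^sup>2) - (q1 x)\<^sup>2 - lam) * y x - q1 x * v x) has_integral v b - v a) {a..b}"
    by (rule fundamental_theorem_of_calculus) (use ab v in \<open>auto intro: has_vector_derivative_at_within\<close>)
  ultimately have "((\<lambda>t. (q t * y t + q1 t * (q1 t * y t + v t)) +
      ((complex_of_real (t\<^sup>2) - (q1 t)\<^sup>2 - lam) * y t - q1 t * v t))
      has_integral (q1 b * y b - q1 a * y a) + (v b - v a)) {a..b}"
    by (rule has_integral_add)
  moreover have "(q t * y t + q1 t * (q1 t * y t + v t)) +
      ((complex_of_real (t\<^sup>2) - (q1 t)\<^sup>2 - lam) * y t - q1 t * v t) =
      (complex_of_real (t\<^sup>2) + q t - lam) * y t" for t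
    by (simp add: algebra_simps power2_eq_square)
  ultimately show "((\<lambda>t. (complex_of_real (t\<^sup>2) + q t - lam) * y t) has_integral
      (q1 b * y b + v b - (q1 a * y a + v a))) {a..b}"
    by (simp add: add_diff_add)
qed

lemma is_sol_lincomb:
  assumes "is_sol q lam y1 y1'" "is_sol q lam y2 y2'"
  shows "is_sol q lam (\<lambda>x. a * y1 x + b * y2 x) (\<lambda>x. a * y1' x + b * y2' x)"
  unfolding is_sol_def
proof (intro conjI allI impI)
  show "((\<lambda>x. a * y1 x + b * y2 x) has_vector_derivative a * y1' x + b * y2' x) (at x)" for x
    using assms by (intro has_vector_derivative_add has_vector_derivative_mult_right) (auto simp: is_sol_def)
  fix u v :: real assume uv: "u \<le> v"
  have "((\<lambda>t. a * ((complex_of_real (t\<^sup>2) + q t - lam) * y1 t) + b * ((complex_of_real (t\<^sup>2) + q t - lam) * y2 t))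
    has_integral a * (y1' v - y1' u) + b * (y2' v - y2' u)) {u..v}"
    using assms uv by (intro has_integral_add has_integral_mult_right) (auto simp: is_sol_def)
  then show "((\<lambda>t. (complex_of_real (t\<^sup>2) + q t - lam) * (a * y1 t + b * y2 t))
    has_integral a * y1' v + b * y2' v - (a * y1' u + b * y2' u)) {u..v}"
    by (simp add: algebra_simps)
qed

text \<open>Passing to quasi-derivatives leaves the Wronskian unchanged, because the
  \<open>q1\<close> terms cancel by antisymmetry, but makes all its factors differentiable.\<close>

lemma wronskian_const:
  assumes "is_sol q lam y1 y1'" "is_sol q lam y2 y2'"
  shows "y1 x * y2' x - y1' x * y2 x = y1 z * y2' z - y1' z * y2 z"
proof -
  let ?v1 = "\<lambda>x. y1' x - q1 x * y1 x" and ?v2 = "\<lambda>x. y2' x - q1 x * y2 x"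
  have d: "(y1 has_vector_derivative y1' x) (at x)" "(y2 has_vector_derivative y2' x) (at x)" for x
    using assms by (auto simp: is_sol_def)
  have e: "y1 x * ?v2 x - ?v1 x * y2 x = y1 x * y2' x - y1' x * y2 x" for x
    by (simp add: right_diff_distrib left_diff_distrib)
  have "((\<lambda>x. y1 x * ?v2 x - ?v1 x * y2 x) has_vector_derivative 0) (at x)" for x
    by (rule has_vector_derivative_eq_rhs, rule has_vector_derivative_diff[OF
        has_vector_derivative_mult[OF d(1) is_sol_imp_quasi_derivative[OF assms(2)]]
        has_vector_derivative_mult[OF is_sol_imp_quasi_derivative[OF assms(1)] d(2)]])
      (simp add: algebra_simps)
  from vector_derivative_zero_imp_const[OF this[unfolded e], of x z]
  show ?thesis .
qed

text \<open>The data \<open>(1, 0)\<close> and \<open>(0, 1)\<close> at 0 are prescribed for the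
  function and its quasi-derivative. As the Wronskian is 1, coefficients of a solution in this basis
  are polynomials in its values, and no division disturbs holomorphy in \<open>lam\<close>.\<close>

lemma fundamental_solutions:
  obtains c c' s s' :: "real \<Rightarrow> complex \<Rightarrow> complex"
  where "\<And>lam. is_sol q lam (\<lambda>x. c x lam) (\<lambda>x. c' x lam)"
    and "\<And>lam. is_sol q lam (\<lambda>x. s x lam) (\<lambda>x. s' x lam)"
    and "\<And>x lam. c x lam * s' x lam - c' x lam * s x lam = 1"
    and "\<And>x. c x holomorphic_on UNIV" "\<And>x. c' x holomorphic_on UNIV"
        "\<And>x. s x holomorphic_on UNIV" "\<And>x. s' x holomorphic_on UNIV"
proof -
  define r where "r x = complex_of_real (x\<^sup>2) - (q1 x)\<^sup>2" for x
  have r: "continuous_on UNIV r" unfolding r_def by (intro continuous_intros q1_continuous)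
  obtain c c2 where c: "\<And>lam. c 0 lam = 1" "\<And>lam. c2 0 lam = 0"
     "\<And>x lam. ((\<lambda>x. c x lam) has_vector_derivative q1 x * c x lam + c2 x lam) (at x)"
     "\<And>x lam. ((\<lambda>x. c2 x lam) has_vector_derivative (r x - lam) * c x lam - q1 x * c2 x lam) (at x)"
     "\<And>x. c x holomorphic_on UNIV" "\<And>x. c2 x holomorphic_on UNIV"
    using linear_system_entire[OF q1_continuous r, of 1 0] by metis
  obtain s s2 where s: "\<And>lam. s 0 lam = 0" "\<And>lam. s2 0 lam = 1"
     "\<And>x lam. ((\<lambda>x. s x lam) has_vector_derivative q1 x * s x lam + s2 x lam) (at x)"
     "\<And>x lam. ((\<lambda>x. s2 x lam) has_vector_derivative (r x - lam) * s x lam - q1 x * s2 x lam) (at x)"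
     "\<And>x. s x holomorphic_on UNIV" "\<And>x. s2 x holomorphic_on UNIV"
    using linear_system_entire[OF q1_continuous r, of 0 1] by metis
  have sols: "is_sol q lam (\<lambda>x. c x lam) (\<lambda>x. q1 x * c x lam + c2 x lam)"
             "is_sol q lam (\<lambda>x. s x lam) (\<lambda>x. q1 x * s x lam + s2 x lam)" for lam
    using is_sol_from_quasi_derivative c(3,4) s(3,4) unfolding r_def by auto
  show ?thesis
  proof (rule that[OF sols])
    show "c x lam * (q1 x * s x lam + s2 x lam) - (q1 x * c x lam + c2 x lam) * s x lam = 1" for x lam
    proof -
      have "c x lam * (q1 x * s x lam + s2 x lam) - (q1 x * c x lam + c2 x lam) * s x lam =
        c 0 lam * (q1 0 * s 0 lam + s2 0 lam) - (q1 0 * c 0 lam + c2 0 lam) * s 0 lam"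
        by (rule wronskian_const[OF sols])
      also have "\<dots> = 1" by (simp add: c(1,2) s(1,2))
      finally show ?thesis .
    qed
    show "(\<lambda>lam. q1 x * c x lam + c2 x lam) holomorphic_on UNIV"
      "(\<lambda>lam. q1 x * s x lam + s2 x lam) holomorphic_on UNIV" for x
      by (intro holomorphic_on_add holomorphic_on_mult holomorphic_on_const c(5,6) s(5,6))+
  qed (rule c(5) s(5))+
qed

text \<open>\<open>g - k f\<close> vanishes at \<open>x0\<close> together with its derivative. That
  it vanishes identically follows from its constant Wronskians with a fundamental pair, in place of
  a Gronwall argument.\<close>

lemma wronskian_zero_imp_proportional:
  assumes f: "is_sol q lam f f'" and g: "is_sol q lam g g'"
    and W: "f z * g' z - f' z * g z = 0" and x0: "f x0 \<noteq> 0"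
  shows "g = (\<lambda>x. g x0 / f x0 * f x)"
proof -
  obtain c c' s s' where cs: "is_sol q lam c c'" "is_sol q lam s s'" "\<And>x. c x * s' x - c' x * s x = 1"
  proof (rule fundamental_solutions)
    fix c c' s s' :: "real \<Rightarrow> complex \<Rightarrow> complex"
    assume "\<And>lam. is_sol q lam (\<lambda>x. c x lam) (\<lambda>x. c' x lam)"
      "\<And>lam. is_sol q lam (\<lambda>x. s x lam) (\<lambda>x. s' x lam)"
      "\<And>x lam. c x lam * s' x lam - c' x lam * s x lam = 1"
    then show thesis by (rule that)
  qed
  define k where "k = g x0 / f x0"
  define y where "y x = g x - k * f x" for x
  define y' where "y' x = g' x - k * f' x" for x
  have y: "is_sol q lam y y'"
    using is_sol_lincomb[OF g f, of 1 "- k"] by (simp add: y_def[abs_def] y'_def[abs_def])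
  have "f x0 * g' x0 - f' x0 * g x0 = 0" using wronskian_const[OF f g, of x0 z] W by simp
  then have y0: "y x0 = 0" "y' x0 = 0" using x0 by (auto simp: y_def y'_def k_def field_simps)
  have "y x = 0" for x
  proof -
    have "y x * c' x - y' x * c x = 0" "y x * s' x - y' x * s x = 0"
      using wronskian_const[OF y cs(1), of x x0] wronskian_const[OF y cs(2), of x x0] y0 by auto
    \<comment> \<open>Cramer's rule: \<open>y\<close> is recovered from its Wronskians with
      \<open>c\<close> and \<open>s\<close>, both zero.\<close>
    moreover have "y x * (c x * s' x - c' x * s x) =
        (y x * s' x - y' x * s x) * c x - (y x * c' x - y' x * c x) * s x"
      by (simp add: algebra_simps)
    ultimately show ?thesis using cs(3)[of x] by simp
  qed
  then have "g x = k * f x" for x unfolding y_def right_minus_eq .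
  then show ?thesis unfolding k_def by (rule ext)
qed

end

subsection \<open>The correction exponent and backward stability\<close>

lemma tail_bound_imp_limit:
  fixes f :: "real \<Rightarrow> complex"
  assumes tail: "\<And>a b. 1 \<le> a \<Longrightarrow> a \<le> b \<Longrightarrow> norm (f b - f a) \<le> K / a"
  shows "\<exists>l. (f \<longlongrightarrow> l) at_top"
proof -
  have "Cauchy (\<lambda>n. f (real n))"
  proof (rule CauchyI)
    fix e :: real assume e: "e > 0"
    obtain M :: nat where M: "real M > max (K / e) 1"
      using reals_Archimedean2 by blast
    have *: "norm (f (real m) - f (real n)) < e" if "m \<ge> M" "n \<ge> m" for m n
    proof -
      have m: "real m \<ge> real M" using that by simp
      then have "real m \<ge> 1" using M by linarith
      have "norm (f (real n) - f (real m)) \<le> K / real m"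
        using that \<open>real m \<ge> 1\<close> by (intro tail) auto
      also have "K / real m < e"
      proof -
        have "K / e < real m" using m M by linarith
        then show ?thesis using e \<open>real m \<ge> 1\<close> by (simp add: field_simps)
      qed
      finally show ?thesis by (simp add: norm_minus_commute)
    qed
    have "norm (f (real m) - f (real n)) < e" if "m \<ge> M" "n \<ge> M" for m n
      using *[of m n] *[of n m] that by (cases "m \<le> n") (auto simp: norm_minus_commute)
    then show "\<exists>M. \<forall>m\<ge>M. \<forall>n\<ge>M. norm (f (real m) - f (real n)) < e" by blast
  qed
  from Cauchy_convergent[OF this, unfolded convergent_def]
  obtain l where l: "(\<lambda>n. f (real n)) \<longlonglongrightarrow> l" by (elim exE)
  have "norm (f a - l) \<le> K / a" if a: "a \<ge> 1" for a
  proof (rule tendsto_upperbound)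
    show "((\<lambda>n. norm (f a - f (real n))) \<longlongrightarrow> norm (f a - l)) sequentially"
      by (intro tendsto_intros l)
    have "\<forall>\<^sub>F n in sequentially. a \<le> real n"
      using filterlim_real_sequentially unfolding filterlim_at_top by blast
    then show "\<forall>\<^sub>F n in sequentially. norm (f a - f (real n)) \<le> K / a"
    proof eventually_elim
      case (elim n)
      show ?case using tail[OF a elim] by (subst norm_minus_commute)
    qed
  qed auto
  then have "\<forall>\<^sub>F a in at_top. norm (f a - l) \<le> K / a"
    by (rule eventually_mono[OF eventually_ge_at_top[of "1::real"]])
  moreover have "((\<lambda>a. K / a) \<longlongrightarrow> 0) at_top"
    by (intro tendsto_divide_0[OF tendsto_const] filterlim_at_top_imp_at_infinity filterlim_ident)
  ultimately have "((\<lambda>a. f a - l) \<longlongrightarrow> 0) at_top"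
    by (rule Lim_null_comparison)
  then show ?thesis using LIM_zero_cancel by blast
qed

text \<open>Replaces estimates of integrals in the asymptotic analysis: a majorant \<open>g\<close>
  with a suitable derivative is exhibited, and no integral is evaluated.\<close>

lemma norm_diff_le_of_derivative_bound:
  fixes f :: "real \<Rightarrow> complex"
  assumes "a \<le> b"
    and f: "\<And>t. a \<le> t \<Longrightarrow> t \<le> b \<Longrightarrow> (f has_vector_derivative f' t) (at t)"
    and g: "\<And>t. a \<le> t \<Longrightarrow> t \<le> b \<Longrightarrow> (g has_real_derivative g' t) (at t)"
    and le: "\<And>t. a \<le> t \<Longrightarrow> t \<le> b \<Longrightarrow> norm (f' t) \<le> g' t"
  shows "norm (f b - f a) \<le> g b - g a"
proof (cases "a = b")
  case False
  with \<open>a \<le> b\<close> have "a < b" by simp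
  then show ?thesis
  proof (rule differentiable_bound_general)
    show "continuous_on {a..b} f"
      by (rule continuous_at_imp_continuous_on) (auto intro: has_vector_derivative_continuous[OF f])
    show "continuous_on {a..b} g"
      by (rule continuous_at_imp_continuous_on) (auto intro: DERIV_isCont[OF g])
    show "(g has_vector_derivative g' t) (at t)" if "a < t" "t < b" for t
      using g[of t] that by (simp add: has_real_derivative_iff_has_vector_derivative)
    show "(f has_vector_derivative f' t) (at t)" if "a < t" "t < b" for t
      using f[of t] that by simp
    show "norm (f' t) \<le> g' t" if "a < t" "t < b" for t
      using le[of t] that by simp
  qed
qed auto

lemma exp_minus_square_le: "exp (- a\<^sup>2) \<le> 1 / a" if "a \<ge> 1" for a :: real
proof -
  have "a \<le> 1 + a\<^sup>2" using that self_le_power[of a 2] by simp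
  also have "\<dots> \<le> exp (a\<^sup>2)" by (rule exp_ge_add_one_self)
  finally show ?thesis using that by (simp add: exp_minus field_simps)
qed

context bounded_potential
begin

text \<open>\<open>w\<close> is the decaying solution of \<open>w' = 2 x w + q\<close>. With \<open>W' = w\<close>, the factor \<open>exp W\<close> absorbs the
  contribution of \<open>q\<close> up to an error \<open>O(1/x\<^sup>2)\<close>, and \<open>W\<close> converges at infinity because
  \<open>w = ((w - q1)/(2 x))' + (w - q1)/(2 x\<^sup>2)\<close>.\<close>

lemma correction_exponent:
  obtains w W :: "real \<Rightarrow> complex"
  where "\<And>x. x \<ge> 1 \<Longrightarrow> norm (w x) \<le> C / x"
    and "\<And>x. ((\<lambda>x. w x - q1 x) has_vector_derivative of_real (2 * x) * w x) (at x)"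
    and "\<And>x. (W has_vector_derivative w x) (at x)"
    and "(W \<longlongrightarrow> 0) at_top"
proof -
  \<comment> \<open>The decaying solution is \<open>w x = - exp (x\<^sup>2)\<close> times the
    integral of \<open>q t exp (- t\<^sup>2)\<close> over \<open>t > x\<close>. Integrating by parts
    turns it into \<open>q1 x + s x\<close>, where \<open>s\<close> involves only the continuous
    density \<open>h\<close>.\<close>
  define h where "h t = (2 * t * exp (- t\<^sup>2)) *\<^sub>R q1 t" for t
  have h: "continuous_on UNIV h" unfolding h_def by (intro continuous_intros q1_continuous)
  define G where "G = antideriv h"
  have G: "(G has_vector_derivative h t) (at t)" for t
    unfolding G_def by (rule antideriv_has_vector_derivative[OF h])
  have dexp: "((\<lambda>t. exp (c - t\<^sup>2)) has_real_derivative - 2 * t * exp (c - t\<^sup>2)) (at t)" for c t :: real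
    by (auto intro!: derivative_eq_intros)
  have Gtail: "norm (G b - G a) \<le> C / a" if "1 \<le> a" "a \<le> b" for a b
  proof -
    have "norm (G b - G a) \<le> (- (C * exp (0 - b\<^sup>2))) - (- (C * exp (0 - a\<^sup>2)))"
    proof (rule norm_diff_le_of_derivative_bound[OF \<open>a \<le> b\<close> G])
      show "((\<lambda>t. - (C * exp (0 - t\<^sup>2))) has_real_derivative 2 * t * exp (- t\<^sup>2) * C) (at t)" for t
        by (auto intro!: derivative_eq_intros)
      show "norm (h t) \<le> 2 * t * exp (- t\<^sup>2) * C" if "a \<le> t" for t
        using that \<open>1 \<le> a\<close> q1_bound[of t] by (auto simp: h_def intro!: mult_left_mono)
    qed
    also have "\<dots> \<le> C * exp (- a\<^sup>2)" using C_nonneg by simp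
    also have "\<dots> \<le> C * (1 / a)" using that C_nonneg by (intro mult_left_mono exp_minus_square_le) auto
    finally show ?thesis by simp
  qed
  obtain g where g: "(G \<longlongrightarrow> g) at_top"
    using tail_bound_imp_limit[OF Gtail] by blast
  define s where "s x = exp (x\<^sup>2) *\<^sub>R (G x - g)" for x
  define w where "w x = q1 x + s x" for x
  have wb: "norm (w x) \<le> C / (2 * x)" if x: "x \<ge> 1" for x
  proof -
    \<comment> \<open>As \<open>2 t exp (x\<^sup>2 - t\<^sup>2)\<close> has integral 1 over
      \<open>t > x\<close>, \<open>w x\<close> is minus the weighted mean of
      \<open>q1 t - q1 x\<close>. \<open>f\<close> is an antiderivative of that integrand, and the
      Lipschitz bound on \<open>q1\<close> supplies the decay in \<open>x\<close>.\<close>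
    define f where "f t = exp (x\<^sup>2) *\<^sub>R G t + exp (x\<^sup>2 - t\<^sup>2) *\<^sub>R q1 x" for t
    \<comment> \<open>Integrating \<open>2 t (t - x) exp (x\<^sup>2 - t\<^sup>2)\<close> by parts
      leaves an integral of \<open>exp (x\<^sup>2 - t\<^sup>2)\<close>; inserting the factor
      \<open>t / x \<ge> 1\<close> makes it elementary and produces the summand
      \<open>1 / (2 * x)\<close>.\<close>
    define H where "H t = ((t - x) + 1 / (2 * x)) * exp (x\<^sup>2 - t\<^sup>2)" for t
    have fd: "(f has_vector_derivative (2 * t * exp (x\<^sup>2 - t\<^sup>2)) *\<^sub>R (q1 t - q1 x)) (at t)" for t
    proof -
      have "(f has_vector_derivative exp (x\<^sup>2) *\<^sub>R h t + (exp (x\<^sup>2 - t\<^sup>2) *\<^sub>R 0 + (- 2 * t * exp (x\<^sup>2 - t\<^sup>2)) *\<^sub>R q1 x)) (at t)"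
        unfolding f_def
        by (intro has_vector_derivative_add has_vector_derivative_scaleR dexp has_vector_derivative_const
            bounded_linear.has_vector_derivative[OF bounded_linear_scaleR_right] G)
      moreover have "exp (x\<^sup>2) *\<^sub>R h t = (2 * t * exp (x\<^sup>2 - t\<^sup>2)) *\<^sub>R q1 t"
        by (simp add: h_def exp_diff exp_minus field_simps)
      ultimately show ?thesis by (simp add: scaleR_diff_right)
    qed
    have Hd: "((\<lambda>t. - (C * H t)) has_real_derivative C * ((2 * t * ((t - x) + 1 / (2 * x)) - 1) * exp (x\<^sup>2 - t\<^sup>2))) (at t)" for t
      unfolding H_def by (rule derivative_eq_intros dexp refl | simp add: algebra_simps)+
    have main: "norm (f b - f x) \<le> C / (2 * x)" if b: "b \<ge> x" for b
    proof -
      have "norm (f b - f x) \<le> - (C * H b) - (- (C * H x))"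
      proof (rule norm_diff_le_of_derivative_bound[OF b fd Hd])
        fix t assume t: "x \<le> t"
        have "norm ((2 * t * exp (x\<^sup>2 - t\<^sup>2)) *\<^sub>R (q1 t - q1 x)) = (2 * t * exp (x\<^sup>2 - t\<^sup>2)) * norm (q1 t - q1 x)"
          using t x by simp
        also have "\<dots> \<le> (2 * t * exp (x\<^sup>2 - t\<^sup>2)) * (C * (t - x))"
          using q1_lipschitz[of t x] t x by (intro mult_left_mono) auto
        also have "\<dots> = C * ((2 * t * (t - x)) * exp (x\<^sup>2 - t\<^sup>2))" by simp
        also have "\<dots> \<le> C * ((2 * t * ((t - x) + 1 / (2 * x)) - 1) * exp (x\<^sup>2 - t\<^sup>2))"
        proof -
          have "1 \<le> t / x" using t x by simp
          then have "2 * t * (t - x) \<le> 2 * t * ((t - x) + 1 / (2 * x)) - 1"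
            by (simp add: algebra_simps)
          then show ?thesis using C_nonneg by (intro mult_left_mono mult_right_mono) auto
        qed
        finally show "norm ((2 * t * exp (x\<^sup>2 - t\<^sup>2)) *\<^sub>R (q1 t - q1 x)) \<le>
            C * ((2 * t * ((t - x) + 1 / (2 * x)) - 1) * exp (x\<^sup>2 - t\<^sup>2))" .
      qed
      also have "\<dots> \<le> C * H x" using C_nonneg b x by (simp add: H_def)
      finally show ?thesis by (simp add: H_def)
    qed
    have lim: "(f \<longlongrightarrow> exp (x\<^sup>2) *\<^sub>R g + 0 *\<^sub>R q1 x) at_top"
      unfolding f_def
    proof (intro tendsto_add tendsto_scaleR tendsto_const g)
      show "((\<lambda>t. exp (x\<^sup>2 - t\<^sup>2)) \<longlongrightarrow> 0) at_top"
      proof (rule Lim_null_comparison)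
        have "norm (exp (x\<^sup>2 - t\<^sup>2)) \<le> exp (x\<^sup>2) * (1 / t)" if "t \<ge> 1" for t
        proof -
          have "norm (exp (x\<^sup>2 - t\<^sup>2)) = exp (x\<^sup>2) * exp (- t\<^sup>2)" by (simp flip: exp_add)
          also have "\<dots> \<le> exp (x\<^sup>2) * (1 / t)"
            by (intro mult_left_mono exp_minus_square_le that) auto
          finally show ?thesis .
        qed
        then show "\<forall>\<^sub>F t in at_top. norm (exp (x\<^sup>2 - t\<^sup>2)) \<le> exp (x\<^sup>2) * (1 / t)"
          by (rule eventually_mono[OF eventually_ge_at_top[of "1::real"]])
        have "((\<lambda>t. 1 / t) \<longlongrightarrow> (0::real)) at_top"
          by (intro tendsto_divide_0[OF tendsto_const] filterlim_at_top_imp_at_infinity filterlim_ident)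
        then show "((\<lambda>t. exp (x\<^sup>2) * (1 / t)) \<longlongrightarrow> 0) at_top"
          by (rule tendsto_mult_right_zero)
      qed
    qed
    have "norm (exp (x\<^sup>2) *\<^sub>R g + 0 *\<^sub>R q1 x - f x) \<le> C / (2 * x)"
    proof (rule tendsto_upperbound)
      show "((\<lambda>b. norm (f b - f x)) \<longlongrightarrow> norm (exp (x\<^sup>2) *\<^sub>R g + 0 *\<^sub>R q1 x - f x)) at_top"
        by (intro tendsto_intros lim)
      show "\<forall>\<^sub>F b in at_top. norm (f b - f x) \<le> C / (2 * x)"
        using eventually_ge_at_top[of x] by eventually_elim (rule main)
    qed auto
    moreover have "exp (x\<^sup>2) *\<^sub>R g + 0 *\<^sub>R q1 x - f x = - w x"
      by (simp add: f_def w_def s_def scaleR_diff_right)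
    ultimately show ?thesis by simp
  qed
  have sd: "(s has_vector_derivative of_real (2 * x) * w x) (at x)" for x
  proof -
    have "((\<lambda>t. exp (t\<^sup>2)) has_real_derivative 2 * x * exp (x\<^sup>2)) (at x)"
      by (auto intro!: derivative_eq_intros)
    then have "(s has_vector_derivative exp (x\<^sup>2) *\<^sub>R (h x - 0) + (2 * x * exp (x\<^sup>2)) *\<^sub>R (G x - g)) (at x)"
      unfolding s_def by (intro has_vector_derivative_scaleR has_vector_derivative_diff G has_vector_derivative_const)
    moreover have "exp (x\<^sup>2) *\<^sub>R (h x - 0) = (2 * x) *\<^sub>R q1 x"
      by (simp add: h_def exp_minus)
    moreover have "(2 * x * exp (x\<^sup>2)) *\<^sub>R (G x - g) = (2 * x) *\<^sub>R s x"
      by (simp add: s_def)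
    ultimately have "(s has_vector_derivative (2 * x) *\<^sub>R q1 x + (2 * x) *\<^sub>R s x) (at x)"
      by (simp only:)
    then show ?thesis by (simp add: w_def scaleR_conv_of_real distrib_left)
  qed
  have scont: "continuous_on UNIV s"
    by (meson sd continuous_at_imp_continuous_on has_vector_derivative_continuous)
  have wcont: "continuous_on UNIV w" unfolding w_def by (intro continuous_intros scont q1_continuous)
  define W0 where "W0 = antideriv w"
  have W0: "(W0 has_vector_derivative w x) (at x)" for x
    unfolding W0_def by (rule antideriv_has_vector_derivative[OF wcont])
  have sb: "norm (s x) \<le> 2 * C" if "x \<ge> 1" for x
  proof -
    have "norm (s x) \<le> norm (w x) + norm (q1 x)"
      using norm_triangle_ineq4[of "w x" "q1 x"] by (simp add: w_def)
    also have "norm (w x) \<le> C"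
    proof -
      have "C / (2 * x) \<le> C / 1" using C_nonneg that by (intro divide_left_mono) auto
      with wb[OF that] show ?thesis by simp
    qed
    finally show ?thesis using q1_bound[of x] by simp
  qed
  \<comment> \<open>Only \<open>s / (2 t\<^sup>2)\<close> is left of the derivative of
    \<open>f\<close>. The bound \<open>2 * C\<close> on \<open>s\<close>, where boundedness of
    \<open>q1\<close> enters, makes it at most \<open>C / t\<^sup>2\<close>.\<close>
  define f where "f t = W0 t - (1 / (2 * t)) *\<^sub>R s t" for t
  have ftail: "norm (f b - f a) \<le> C / a" if "1 \<le> a" "a \<le> b" for a b
  proof -
    have "norm (f b - f a) \<le> (- (C / b)) - (- (C / a))"
    proof (rule norm_diff_le_of_derivative_bound[OF \<open>a \<le> b\<close>])
      fix t assume t: "a \<le> t"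
      then have t1: "t \<ge> 1" "t > 0" using \<open>1 \<le> a\<close> by auto
      have "((\<lambda>t. 1 / (2 * t)) has_real_derivative - (1 / (2 * t\<^sup>2))) (at t)"
        using t1 by (auto intro!: derivative_eq_intros simp: power2_eq_square)
      then have "(f has_vector_derivative w t - ((1 / (2 * t)) *\<^sub>R (of_real (2 * t) * w t) + (- (1 / (2 * t\<^sup>2))) *\<^sub>R s t)) (at t)"
        unfolding f_def by (intro has_vector_derivative_diff has_vector_derivative_scaleR W0 sd)
      moreover have "(1 / (2 * t)) *\<^sub>R (of_real (2 * t) * w t) = w t"
        using t1 by (simp add: scaleR_conv_of_real)
      ultimately show "(f has_vector_derivative (1 / (2 * t\<^sup>2)) *\<^sub>R s t) (at t)" by simp
      show "((\<lambda>t. - (C / t)) has_real_derivative C / t\<^sup>2) (at t)"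
        using t1 by (auto intro!: derivative_eq_intros simp: power2_eq_square)
      show "norm ((1 / (2 * t\<^sup>2)) *\<^sub>R s t) \<le> C / t\<^sup>2"
        using sb[OF t1(1)] t1 by (simp add: field_simps)
    qed
    also have "\<dots> \<le> C / a" using C_nonneg that by simp
    finally show ?thesis .
  qed
  obtain l where l: "(f \<longlongrightarrow> l) at_top"
    using tail_bound_imp_limit[OF ftail] by blast
  have "((\<lambda>t. (1 / (2 * t)) *\<^sub>R s t) \<longlongrightarrow> 0) at_top"
  proof (rule Lim_null_comparison)
    have "norm ((1 / (2 * t)) *\<^sub>R s t) \<le> C / t" if "t \<ge> 1" for t
      using sb[OF that] that by (simp add: field_simps)
    then show "\<forall>\<^sub>F t in at_top. norm ((1 / (2 * t)) *\<^sub>R s t) \<le> C / t"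
      by (rule eventually_mono[OF eventually_ge_at_top[of "1::real"]])
    show "((\<lambda>t. C / t) \<longlongrightarrow> 0) at_top"
      by (intro tendsto_divide_0[OF tendsto_const] filterlim_at_top_imp_at_infinity filterlim_ident)
  qed
  from tendsto_add[OF l this] have W0l: "(W0 \<longlongrightarrow> l) at_top" by (simp add: f_def)
  \<comment> \<open>Subtracting the limit makes \<open>W\<close> vanish at infinity, so that the
    leading coefficient of the asymptotics is exactly 1.\<close>
  show ?thesis
  proof (rule that[of w "\<lambda>x. W0 x - l"])
    show "norm (w x) \<le> C / x" if "x \<ge> 1" for x
    proof -
      have "C / (2 * x) \<le> C / x" using C_nonneg that by (intro divide_left_mono) auto
      with wb[OF that] show ?thesis by simp
    qed
    show "((\<lambda>x. w x - q1 x) has_vector_derivative of_real (2 * x) * w x) (at x)" for x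
      using sd[of x] by (simp add: w_def)
    show "((\<lambda>x. W0 x - l) has_vector_derivative w x) (at x)" for x
      using W0[of x] by (auto intro!: derivative_eq_intros)
    show "((\<lambda>x. W0 x - l) \<longlongrightarrow> 0) at_top" using W0l by (simp add: LIM_zero)
  qed
qed

end

text \<open>Since \<open>e' \<le> - e\<close>, the weight at \<open>t > y\<close> is smaller than at
  \<open>y\<close> by at least the factor \<open>exp (y - t)\<close>. Integrating down from
  \<open>n\<close> therefore damps \<open>\<theta> n\<close>, and the bounds do not grow with
  \<open>n - x\<close>. They are linear in the unknown maximum of \<open>|\<zeta>|\<close>;
  \<open>2 * T \<le> X\<close> lets half of it be absorbed, whence the factor 2 in
  \<open>B\<close>.\<close>

lemma backward_stability:
  fixes \<zeta> \<theta> E \<tau> :: "real \<Rightarrow> complex" and e e' :: "real \<Rightarrow> real"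
  assumes X: "X \<ge> 1" "2 * T \<le> X" "T \<ge> 0"
    and d\<zeta>: "\<And>t. X \<le> t \<Longrightarrow> (\<zeta> has_vector_derivative \<theta> t) (at t)"
    and dE: "\<And>t. X \<le> t \<Longrightarrow> ((\<lambda>t. E t * \<theta> t) has_vector_derivative - (\<tau> t * E t * \<zeta> t)) (at t)"
    and E: "\<And>t. X \<le> t \<Longrightarrow> norm (E t) = e t" "\<And>t. X \<le> t \<Longrightarrow> e t > 0"
    and e: "\<And>t. X \<le> t \<Longrightarrow> (e has_real_derivative e' t) (at t)" "\<And>t. X \<le> t \<Longrightarrow> e' t \<le> - e t"
    and \<tau>: "\<And>t. X \<le> t \<Longrightarrow> norm (\<tau> t) \<le> T / t\<^sup>2"
    and x: "X \<le> x" "x \<le> n"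
  defines "B \<equiv> 2 * (norm (\<zeta> n) + norm (\<theta> n))"
  shows "norm (\<zeta> x) \<le> B" "norm (\<theta> x) \<le> norm (\<theta> n) + T * B / x\<^sup>2"
    "norm (\<zeta> x - \<zeta> n) \<le> norm (\<theta> n) + T * B / x"
proof -
  have "continuous_on {X..n} (\<lambda>t. norm (\<zeta> t))"
    by (intro continuous_on_norm continuous_at_imp_continuous_on)
      (auto intro: has_vector_derivative_continuous[OF d\<zeta>])
  then obtain z where z: "z \<in> {X..n}" "\<And>t. t \<in> {X..n} \<Longrightarrow> norm (\<zeta> t) \<le> norm (\<zeta> z)"
    using continuous_attains_sup[of "{X..n}" "\<lambda>t. norm (\<zeta> t)"] x by fastforce
  define S where "S = norm (\<zeta> z)"
  have S: "S \<ge> 0" by (simp add: S_def)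
  have th: "norm (\<theta> y) \<le> norm (\<theta> n) * exp (y - n) + T * S / y\<^sup>2" if y: "X \<le> y" "y \<le> n" for y
  proof -
    have y1: "y \<ge> 1" using y X by simp
    \<comment> \<open>On \<open>{y..n}\<close> the source is at most
      \<open>T * S / y\<^sup>2\<close> times \<open>e \<le> - e'\<close>, and \<open>- e'\<close>
      integrates exactly.\<close>
    have "norm (E n * \<theta> n - E y * \<theta> y) \<le> - (T * S / y\<^sup>2 * e n) - (- (T * S / y\<^sup>2 * e y))"
    proof (rule norm_diff_le_of_derivative_bound[OF \<open>y \<le> n\<close>, where f = "\<lambda>t. E t * \<theta> t"])
      fix t assume t: "y \<le> t" "t \<le> n"
      have Xt: "X \<le> t" using t y by simp
      show "((\<lambda>t. E t * \<theta> t) has_vector_derivative - (\<tau> t * E t * \<zeta> t)) (at t)" by (rule dE[OF Xt])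
      show "((\<lambda>t. - (T * S / y\<^sup>2 * e t)) has_real_derivative - (T * S / y\<^sup>2 * e' t)) (at t)"
        by (intro DERIV_minus DERIV_cmult e Xt)
      have "T / t\<^sup>2 \<le> T / y\<^sup>2"
        using t y1 X by (intro divide_left_mono power_mono mult_pos_pos zero_less_power) auto
      then have "norm (\<tau> t) \<le> T / y\<^sup>2" using \<tau>[OF Xt] by linarith
      moreover have "norm (\<zeta> t) \<le> S" using z(2)[of t] t y by (simp add: S_def)
      moreover have "norm (- (\<tau> t * E t * \<zeta> t)) = norm (\<tau> t) * e t * norm (\<zeta> t)"
        by (simp only: norm_minus_cancel norm_mult E(1)[OF Xt])
      ultimately have "norm (- (\<tau> t * E t * \<zeta> t)) \<le> T / y\<^sup>2 * e t * S"
        using E(2)[OF Xt] X by (simp only:) (intro mult_mono mult_right_mono, auto)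
      also have "\<dots> = T * S / y\<^sup>2 * e t" by simp
      also have "\<dots> \<le> T * S / y\<^sup>2 * (- e' t)"
        using e(2)[OF Xt] X S by (intro mult_left_mono) auto
      finally show "norm (- (\<tau> t * E t * \<zeta> t)) \<le> - (T * S / y\<^sup>2 * e' t)" by simp
    qed
    also have "\<dots> \<le> T * S / y\<^sup>2 * e y" using X S E(2)[of n] y by simp
    finally have "norm (E y * \<theta> y) \<le> norm (E n * \<theta> n) + T * S / y\<^sup>2 * e y"
      using norm_triangle_sub[of "E y * \<theta> y" "E n * \<theta> n"] by (simp add: norm_minus_commute)
    then have 1: "e y * norm (\<theta> y) \<le> e n * norm (\<theta> n) + T * S / y\<^sup>2 * e y"
      using E(1) y by (simp add: norm_mult)
    \<comment> \<open>The damping factor is kept rather than bounded by 1: its integral in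
      \<open>y\<close> is at most 1, whereas an undamped \<open>|\<theta> n|\<close> would be
      multiplied by the length \<open>n - y\<close> on passing to \<open>\<zeta>\<close>.\<close>
    have "e n * exp n \<le> e y * exp y"
    proof (rule DERIV_nonpos_imp_nonincreasing[OF \<open>y \<le> n\<close>])
      fix t assume t: "y \<le> t" "t \<le> n"
      have Xt: "X \<le> t" using t y by simp
      have "((\<lambda>t. e t * exp t) has_real_derivative (e' t + e t) * exp t) (at t)"
        by (auto intro!: derivative_eq_intros e[OF Xt] simp: algebra_simps)
      moreover have "(e' t + e t) * exp t \<le> 0"
        using e(2)[OF Xt] by (intro mult_nonpos_nonneg) auto
      ultimately show "\<exists>k. ((\<lambda>t. e t * exp t) has_real_derivative k) (at t) \<and> k \<le> 0" by blast
    qed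
    then have "e n \<le> e y * exp (y - n)" by (simp add: exp_diff field_simps)
    then have "e n * norm (\<theta> n) \<le> e y * exp (y - n) * norm (\<theta> n)"
      by (intro mult_right_mono) auto
    with 1 have "e y * norm (\<theta> y) \<le> e y * (norm (\<theta> n) * exp (y - n) + T * S / y\<^sup>2)"
      by (simp add: algebra_simps)
    then show ?thesis using E(2)[OF y(1)] mult_le_cancel_left_pos by blast
  qed
  have ze: "norm (\<zeta> n - \<zeta> y) \<le> norm (\<theta> n) + T * S / y" if y: "X \<le> y" "y \<le> n" for y
  proof -
    have "norm (\<zeta> n - \<zeta> y) \<le> (norm (\<theta> n) * exp (n - n) - T * S / n) - (norm (\<theta> n) * exp (y - n) - T * S / y)"
    proof (rule norm_diff_le_of_derivative_bound[OF \<open>y \<le> n\<close>])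
      fix t assume t: "y \<le> t" "t \<le> n"
      have Xt: "X \<le> t" using t y by simp
      show "(\<zeta> has_vector_derivative \<theta> t) (at t)" by (rule d\<zeta>[OF Xt])
      show "((\<lambda>t. norm (\<theta> n) * exp (t - n) - T * S / t) has_real_derivative
          norm (\<theta> n) * exp (t - n) + T * S / t\<^sup>2) (at t)"
        using Xt X by (auto intro!: derivative_eq_intros simp: power2_eq_square)
      show "norm (\<theta> t) \<le> norm (\<theta> n) * exp (t - n) + T * S / t\<^sup>2" using th[OF Xt t(2)] .
    qed
    also have "\<dots> \<le> norm (\<theta> n) + T * S / y"
    proof -
      have "0 \<le> T * S / n" "0 \<le> norm (\<theta> n) * exp (y - n)" using X S y by auto
      then show ?thesis unfolding diff_self exp_zero mult_1_right by linarith
    qed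
    finally show ?thesis .
  qed
  have zX: "X \<le> z" "z \<le> n" using z(1) by auto
  have SB: "S \<le> B"
  proof -
    have "S \<le> norm (\<zeta> n) + norm (\<zeta> n - \<zeta> z)"
      using norm_triangle_sub[of "\<zeta> z" "\<zeta> n"] by (simp add: S_def norm_minus_commute)
    also have "\<dots> \<le> norm (\<zeta> n) + (norm (\<theta> n) + T * S / z)" using ze[OF zX] by simp
    also have "T * S / z \<le> S / 2"
    proof -
      have "2 * T \<le> z" "z > 0" using X zX by auto
      then have "2 * T * S \<le> z * S" using S by (intro mult_right_mono) auto
      then show ?thesis using \<open>z > 0\<close> by (simp add: field_simps)
    qed
    finally show ?thesis by (simp add: B_def)
  qed
  have x1: "x \<ge> 1" using x X by simp
  show "norm (\<zeta> x) \<le> B" using z(2)[of x] x SB by (simp add: S_def)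
  have TS: "T * S / k \<le> T * B / k" if "k > 0" for k
    using SB X that by (intro divide_right_mono mult_left_mono) auto
  have "norm (\<theta> n) * exp (x - n) \<le> norm (\<theta> n) * 1" using x by (intro mult_left_mono) auto
  then show "norm (\<theta> x) \<le> norm (\<theta> n) + T * B / x\<^sup>2"
    using th[OF x] TS[of "x\<^sup>2"] x1 by simp
  show "norm (\<zeta> x - \<zeta> n) \<le> norm (\<theta> n) + T * B / x"
    using ze[OF x] TS[of x] x1 by (simp add: norm_minus_commute)
qed

subsection \<open>The recessive solution\<close>

lemma holomorphic_limit_of_rate:
  fixes f :: "nat \<Rightarrow> complex \<Rightarrow> complex"
  assumes hol: "\<And>n. f n holomorphic_on UNIV"
    and rate: "\<And>R. R \<ge> 0 \<Longrightarrow> \<exists>Q X. \<forall>lam n m. norm lam \<le> R \<and> X \<le> real n \<and> n \<le> m \<longrightarrow>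
        norm (f m lam - f n lam) \<le> Q / real n"
  obtains g where "g holomorphic_on UNIV" "\<And>lam. (\<lambda>n. f n lam) \<longlonglongrightarrow> g lam"
proof -
  define g where "g lam = lim (\<lambda>n. f n lam)" for lam
  have ul: "uniform_limit (cball 0 R) f g sequentially" if R: "R \<ge> 0" for R
  proof -
    obtain Q X where Q: "\<And>lam n m. norm lam \<le> R \<Longrightarrow> X \<le> real n \<Longrightarrow> n \<le> m \<Longrightarrow>
        norm (f m lam - f n lam) \<le> Q / real n"
      using rate[OF R] by blast
    have "uniformly_Cauchy_on (cball 0 R) f"
    proof (rule uniformly_Cauchy_onI')
      fix e :: real assume e: "e > 0"
      obtain M :: nat where M: "real M > max (max X 1) (Q / e)"
        using reals_Archimedean2 by blast
      have "dist (f m lam) (f n lam) < e" if "lam \<in> cball 0 R" "m \<ge> M" "n > m" for lam m n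
      proof -
        have m: "real m \<ge> real M" using that by simp
        then have m1: "real m \<ge> 1" "X \<le> real m" "Q / e < real m" using M by linarith+
        have "norm (f n lam - f m lam) \<le> Q / real m"
          using that m1 by (intro Q) auto
        also have "\<dots> < e" using m1 e by (simp add: field_simps)
        finally show ?thesis by (simp add: dist_norm norm_minus_commute)
      qed
      then show "\<exists>M. \<forall>x\<in>cball 0 R. \<forall>m\<ge>M. \<forall>n>m. dist (f m x) (f n x) < e" by blast
    qed
    then have "uniformly_convergent_on (cball 0 R) f" by (rule Cauchy_uniformly_convergent)
    then show ?thesis by (simp add: uniformly_convergent_uniform_limit_iff g_def[abs_def])
  qed
  show ?thesis
  proof (rule that[of g])
    show "g holomorphic_on UNIV"
      by (rule holomorphic_sequence_locally_uniform[of f g, OF hol ul]) auto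
    show "(\<lambda>n. f n lam) \<longlonglongrightarrow> g lam" for lam
      by (rule tendsto_uniform_limitI[OF ul[of "norm lam"]]) auto
  qed
qed

lemma uniform_limit_at_top_of_rate:
  fixes f :: "real \<Rightarrow> 'a \<Rightarrow> 'b::real_normed_vector"
  assumes "\<And>x a. x \<ge> X \<Longrightarrow> a \<in> K \<Longrightarrow> norm (f x a - l a) \<le> B / x"
  shows "uniform_limit K f l at_top"
proof (rule uniform_limitI)
  fix e :: real assume e: "e > 0"
  have "\<forall>\<^sub>F x in at_top. x > max (max X 1) (B / e)" by (rule eventually_gt_at_top)
  then show "\<forall>\<^sub>F x in at_top. \<forall>a\<in>K. dist (f x a) (l a) < e"
  proof eventually_elim
    case (elim x)
    then have x: "x \<ge> X" "x > 1" "B / e < x" by linarith+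
    then have "B / x < e" using e by (simp add: field_simps)
    then show ?case using assms[OF x(1)] by (force simp: dist_norm)
  qed
qed

text \<open>Fixes the output of \<open>correction_exponent\<close> so that the comparison functions
  can be defined from it. Like \<open>q1\<close>, \<open>w\<close> need not be differentiable, so
  its equation is expressed through \<open>w - q1\<close>.\<close>

locale corrected_potential = bounded_potential +
  fixes w W :: "real \<Rightarrow> complex"
  assumes w_bound: "x \<ge> 1 \<Longrightarrow> norm (w x) \<le> C / x"
    and w_deriv: "((\<lambda>x. w x - q1 x) has_vector_derivative of_real (2 * x) * w x) (at x)"
    and W_deriv: "(W has_vector_derivative w x) (at x)"
    and W_lim: "(W \<longlongrightarrow> 0) at_top"
begin

text \<open>The approximate recessive solution is \<open>D = exp L\<close> with \<open>p = L'\<close>; formally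
  \<open>D'' = (x\<^sup>2 + q - \<lambda> + \<tau>) D\<close> with \<open>\<tau> = O(1/x\<^sup>2)\<close>.\<close>

definition L :: "real \<Rightarrow> complex \<Rightarrow> complex" where
  "L x lam = (lam - 1) / 2 * of_real (ln (sqrt 2 * x)) - of_real (x\<^sup>2 / 2) + W x"

definition D :: "real \<Rightarrow> complex \<Rightarrow> complex" where
  "D x lam = exp (L x lam)"

definition p :: "real \<Rightarrow> complex \<Rightarrow> complex" where
  "p x lam = (lam - 1) / 2 / of_real x - of_real x + w x"

text \<open>The residual of the Riccati equation: with \<open>m = (lam - 1) / 2\<close>, formally
  \<open>p' + p\<^sup>2 = x\<^sup>2 + q - lam + \<tau>\<close>. The terms \<open>2 x w\<close>
  cancel by the choice of \<open>w\<close>, and \<open>- 2 m - 1 = - lam\<close> dictates the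
  exponent \<open>m\<close>.\<close>

definition \<tau> :: "real \<Rightarrow> complex \<Rightarrow> complex" where
  "\<tau> x lam = (((lam - 1) / 2)\<^sup>2 - (lam - 1) / 2) / of_real (x\<^sup>2) + (lam - 1) * w x / of_real x + (w x)\<^sup>2"

definition \<zeta> :: "complex \<Rightarrow> (real \<Rightarrow> complex) \<Rightarrow> real \<Rightarrow> complex" where
  "\<zeta> lam y x = y x / D x lam"

text \<open>Written through the pair \<open>(y, y')\<close> and not as a derivative: linearity in
  the pair and stability under its pointwise limits are then immediate, and the approximating
  sequence uses both.\<close>

definition \<theta> :: "complex \<Rightarrow> (real \<Rightarrow> complex) \<Rightarrow> (real \<Rightarrow> complex) \<Rightarrow> real \<Rightarrow> complex" where
  "\<theta> lam y y' x = (y' x - p x lam * y x) / D x lam"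

lemma D_nonzero [simp]: "D x lam \<noteq> 0"
  by (simp add: D_def)

lemma D_eq_Aplus:
  assumes "x > 0"
  shows "D x lam = Aplus x lam * exp (W x)"
proof -
  have "sqrt 2 * x > 0" using assms by simp
  then have "Aplus x lam = exp ((lam - 1) / 2 * of_real (ln (sqrt 2 * x)) + of_real (- (x\<^sup>2) / 2))"
    unfolding Aplus_def powr_def exp_add by (subst Ln_of_real) auto
  moreover have "of_real (- (x\<^sup>2) / 2) = - complex_of_real (x\<^sup>2 / 2)" by simp
  ultimately show ?thesis by (simp only: D_def L_def exp_add diff_conv_add_uminus)
qed

lemma L_deriv:
  assumes "x > 0"
  shows "((\<lambda>x. L x lam) has_vector_derivative p x lam) (at x)"
proof -
  have "((\<lambda>x. ln (sqrt 2 * x)) has_real_derivative 1 / x) (at x)"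
    using assms by (auto intro!: derivative_eq_intros)
  then have 1: "((\<lambda>x. complex_of_real (ln (sqrt 2 * x))) has_vector_derivative of_real (1 / x)) (at x)"
    by (rule has_vector_derivative_of_real)
  have "((\<lambda>x. x\<^sup>2 / 2) has_real_derivative x) (at x)"
    by (auto intro!: derivative_eq_intros)
  then have 2: "((\<lambda>x. complex_of_real (x\<^sup>2 / 2)) has_vector_derivative of_real x) (at x)"
    by (rule has_vector_derivative_of_real)
  have "((\<lambda>x. L x lam) has_vector_derivative ((lam - 1) / 2 * of_real (1 / x) - of_real x + w x)) (at x)"
    unfolding L_def by (intro has_vector_derivative_add has_vector_derivative_diff has_vector_derivative_mult_right 1 2 W_deriv)
  then show ?thesis by (simp add: p_def)
qed

lemma D_deriv:
  assumes "x > 0"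
  shows "((\<lambda>x. D x lam) has_vector_derivative p x lam * D x lam) (at x)"
  using field_vector_diff_chain_at[OF L_deriv[OF assms, of lam] DERIV_exp]
  by (simp add: D_def o_def)

lemma \<zeta>_deriv:
  assumes sol: "is_sol q lam y y'" and x: "x > 0"
  shows "(\<zeta> lam y has_vector_derivative \<theta> lam y y' x) (at x)"
proof -
  have y: "(y has_vector_derivative y' x) (at x)" using sol by (simp add: is_sol_def)
  have "((\<lambda>x. exp (- L x lam)) has_vector_derivative (- p x lam) * exp (- L x lam)) (at x)"
    using field_vector_diff_chain_at[OF has_vector_derivative_minus[OF L_deriv[OF x, of lam]] DERIV_exp]
    by (simp add: o_def)
  from has_vector_derivative_mult[OF y this]
  show ?thesis
    by (simp add: \<zeta>_def[abs_def] \<theta>_def D_def exp_minus field_simps)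
qed

text \<open>Neither \<open>y'\<close> nor \<open>p y\<close> need be differentiable, but
  \<open>N = y' - p y\<close> is: in \<open>(y' - q1 y) - (p - q1) y\<close> the rough parts have
  cancelled. This gives \<open>N' = - \<tau> y - p N\<close>, and the factor \<open>D\<close>
  removes the term \<open>p N\<close>; the weighted quantity equals \<open>D N\<close>.\<close>

lemma weighted_\<theta>_deriv:
  assumes sol: "is_sol q lam y y'" and x: "x > 0"
  shows "((\<lambda>x. (D x lam)\<^sup>2 * \<theta> lam y y' x) has_vector_derivative
      - (\<tau> x lam * (D x lam)\<^sup>2 * \<zeta> lam y x)) (at x)"
proof -
  define m where "m = (lam - 1) / 2"
  \<comment> \<open>Treating \<open>1 / x\<close> as a variable with \<open>r * x = 1\<close> makes
    the identity for \<open>N'\<close> polynomial.\<close>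
  define r where "r = 1 / complex_of_real x"
  have rx: "r * of_real x = 1" using x by (simp add: r_def)
  have lam: "lam = 2 * m + 1" by (simp add: m_def field_simps)
  let ?N = "\<lambda>x. y' x - p x lam * y x"
  let ?X = "complex_of_real x"
  have y: "(y has_vector_derivative y' x) (at x)" using sol by (simp add: is_sol_def)
  have "((\<lambda>x. m * complex_of_real (1 / x) - of_real x + (w x - q1 x)) has_vector_derivative
     m * of_real (- (1 / x\<^sup>2)) - of_real 1 + of_real (2 * x) * w x) (at x)"
    using x by (intro has_vector_derivative_add has_vector_derivative_diff has_vector_derivative_mult_right
        has_vector_derivative_of_real w_deriv)
      (auto intro!: derivative_eq_intros simp: power2_eq_square)
  from has_vector_derivative_diff[OF is_sol_imp_quasi_derivative[OF sol, of x] has_vector_derivative_mult[OF this y]]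
  have "((\<lambda>x. (y' x - q1 x * y x) - (m * complex_of_real (1 / x) - of_real x + (w x - q1 x)) * y x)
     has_vector_derivative ((?X\<^sup>2 - lam) * y x - q1 x * y' x) -
     ((m * r - ?X + (w x - q1 x)) * y' x + (- m * r\<^sup>2 - 1 + 2 * ?X * w x) * y x)) (at x)"
    by (simp add: r_def power_divide)
  moreover have "(\<lambda>x. (y' x - q1 x * y x) - (m * complex_of_real (1 / x) - of_real x + (w x - q1 x)) * y x) = ?N"
    by (rule ext) (simp add: p_def m_def[symmetric] left_diff_distrib distrib_right)
  ultimately have "(?N has_vector_derivative ((?X\<^sup>2 - lam) * y x - q1 x * y' x) -
     ((m * r - ?X + (w x - q1 x)) * y' x + (- m * r\<^sup>2 - 1 + 2 * ?X * w x) * y x)) (at x)"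
    by (simp only:)
  moreover have "((?X\<^sup>2 - lam) * y x - q1 x * y' x) -
     ((m * r - ?X + (w x - q1 x)) * y' x + (- m * r\<^sup>2 - 1 + 2 * ?X * w x) * y x) =
     - ((m\<^sup>2 - m) * r\<^sup>2 + 2 * m * w x * r + (w x)\<^sup>2) * y x - (m * r - ?X + w x) * (y' x - (m * r - ?X + w x) * y x)"
    using rx unfolding lam by algebra
  moreover have "\<tau> x lam = (m\<^sup>2 - m) * r\<^sup>2 + 2 * m * w x * r + (w x)\<^sup>2"
    by (simp add: \<tau>_def m_def[symmetric] r_def power_divide) (simp add: lam)
  moreover have "p x lam = m * r - ?X + w x"
    by (simp add: p_def m_def[symmetric] r_def)
  ultimately have "(?N has_vector_derivative - \<tau> x lam * y x - p x lam * ?N x) (at x)"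
    by simp
  from has_vector_derivative_mult[OF D_deriv[OF x, of lam] this]
  have "((\<lambda>x. D x lam * ?N x) has_vector_derivative - (\<tau> x lam * D x lam * y x)) (at x)"
    by (simp add: algebra_simps)
  moreover have "(\<lambda>x. D x lam * ?N x) = (\<lambda>x. (D x lam)\<^sup>2 * \<theta> lam y y' x)"
    by (simp add: \<theta>_def power2_eq_square)
  moreover have "D x lam * y x = (D x lam)\<^sup>2 * \<zeta> lam y x"
    by (simp add: \<zeta>_def power2_eq_square)
  ultimately show ?thesis by (simp add: mult.assoc)
qed

lemma norm_D_square_deriv:
  assumes "x > 0"
  shows "((\<lambda>x. norm ((D x lam)\<^sup>2)) has_real_derivative 2 * Re (p x lam) * norm ((D x lam)\<^sup>2)) (at x)"
proof -
  have n: "norm ((D x lam)\<^sup>2) = exp (2 * Re (L x lam))" for x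
    by (simp add: D_def norm_power norm_exp_eq_Re power2_eq_square flip: exp_add)
  have "((\<lambda>x. Re (L x lam)) has_real_derivative Re (p x lam)) (at x)"
    using bounded_linear.has_vector_derivative[OF bounded_linear_Re L_deriv[OF assms]]
    by (simp add: has_real_derivative_iff_has_vector_derivative)
  from DERIV_fun_exp[OF DERIV_cmult[OF this, of 2]]
  show ?thesis unfolding n by (simp add: mult_ac)
qed

lemma coefficient_bounds:
  assumes "R \<ge> 0" "norm lam \<le> R" "t \<ge> 1"
  shows "norm (p t lam + of_real t) \<le> (R + 1 + C) / t"
    and "norm (\<tau> t lam) \<le> ((R + 1)\<^sup>2 + (R + 1) + 2 * (R + 1) * C + C\<^sup>2) / t\<^sup>2"
proof -
  define m where "m = (lam - 1) / 2"
  have "norm m \<le> (norm lam + 1) / 2"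
    using norm_triangle_ineq4[of lam 1] by (simp add: m_def norm_divide)
  also have "(norm lam + 1) / 2 \<le> R + 1" using assms by simp
  finally have m: "norm m \<le> R + 1" .
  have wb: "norm (w t) \<le> C / t" using assms by (intro w_bound) auto
  have "norm (p t lam + of_real t) = norm (m / of_real t + w t)" by (simp add: p_def m_def)
  also have "\<dots> \<le> norm m / t + norm (w t)"
    using norm_triangle_ineq[of "m / of_real t" "w t"] assms by (simp add: norm_divide)
  also have "\<dots> \<le> (R + 1) / t + C / t"
    using m wb assms by (intro add_mono divide_right_mono) auto
  finally show "norm (p t lam + of_real t) \<le> (R + 1 + C) / t" by (simp add: add_divide_distrib)
  have "lam - 1 = 2 * m" by (simp add: m_def)
  then have "\<tau> t lam = (m\<^sup>2 - m) / of_real (t\<^sup>2) + 2 * m * w t / of_real t + (w t)\<^sup>2"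
    by (simp only: \<tau>_def) simp
  also have "norm \<dots> \<le> norm (m\<^sup>2 - m) / t\<^sup>2 + 2 * norm m * norm (w t) / t + (norm (w t))\<^sup>2"
    using assms by (intro order_trans[OF norm_triangle_ineq] add_mono)
      (auto simp: norm_divide norm_mult norm_power)
  also have "\<dots> \<le> ((R + 1)\<^sup>2 + (R + 1)) / t\<^sup>2 + 2 * (R + 1) * (C / t) / t + (C / t)\<^sup>2"
  proof (intro add_mono divide_right_mono power_mono mult_mono)
    show "norm (m\<^sup>2 - m) \<le> (R + 1)\<^sup>2 + (R + 1)"
    proof -
      have "norm (m\<^sup>2) \<le> (R + 1)\<^sup>2" using m by (simp add: norm_power power_mono)
      then show ?thesis using norm_triangle_ineq4[of "m\<^sup>2" m] m by linarith
    qed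
  qed (use m wb assms in auto)
  also have "\<dots> = ((R + 1)\<^sup>2 + (R + 1) + 2 * (R + 1) * C + C\<^sup>2) / t\<^sup>2"
    using assms by (simp add: field_simps power2_eq_square)
  finally show "norm (\<tau> t lam) \<le> ((R + 1)\<^sup>2 + (R + 1) + 2 * (R + 1) * C + C\<^sup>2) / t\<^sup>2" .
qed

text \<open>Backward stability with the weight \<open>D\<^sup>2\<close>, whose norm has logarithmic
  derivative \<open>2 Re p\<close>; \<open>Re p \<le> - 1 / 2\<close> is exactly the decay required
  there. \<open>X\<close> and \<open>T\<close> depend on \<open>R\<close> alone, so the estimates
  are uniform in \<open>lam\<close>, in the solution and in \<open>n\<close>.\<close>

lemma solution_stability:
  assumes R: "R \<ge> 0"
  obtains X T where "X \<ge> 1" "T \<ge> 0"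
    and "\<And>lam t. norm lam \<le> R \<Longrightarrow> t \<ge> X \<Longrightarrow> Re (p t lam) \<le> - 1 / 2"
    and "\<And>lam y y' x n. norm lam \<le> R \<Longrightarrow> is_sol q lam y y' \<Longrightarrow> X \<le> x \<Longrightarrow> x \<le> n \<Longrightarrow>
        norm (\<zeta> lam y x) \<le> 2 * (norm (\<zeta> lam y n) + norm (\<theta> lam y y' n)) \<and>
        norm (\<theta> lam y y' x) \<le> norm (\<theta> lam y y' n) + T * (2 * (norm (\<zeta> lam y n) + norm (\<theta> lam y y' n))) / x\<^sup>2 \<and>
        norm (\<zeta> lam y x - \<zeta> lam y n) \<le> norm (\<theta> lam y y' n) + T * (2 * (norm (\<zeta> lam y n) + norm (\<theta> lam y y' n))) / x"
proof -
  define T where "T = (R + 1)\<^sup>2 + (R + 1) + 2 * (R + 1) * C + C\<^sup>2"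
  \<comment> \<open>For \<open>t \<ge> X\<close> this gives
    \<open>Re p \<le> R + 1 + C - t \<le> - 1 - 2 T\<close>; the summand \<open>2 * T\<close> serves
    the absorption.\<close>
  define X where "X = R + 2 + C + 2 * T"
  have T: "T \<ge> 0" using R C_nonneg by (simp add: T_def)
  have X: "X \<ge> 1" "2 * T \<le> X" using R T C_nonneg by (auto simp: X_def)
  have Rep: "Re (p t lam) \<le> - 1 / 2" if "norm lam \<le> R" "t \<ge> X" for lam t
  proof -
    have t1: "t \<ge> 1" using X that by linarith
    have "Re (p t lam) + t \<le> norm (p t lam + of_real t)"
      using complex_Re_le_cmod[of "p t lam + of_real t"] by simp
    also have "\<dots> \<le> (R + 1 + C) / t" by (rule coefficient_bounds[OF R that(1) t1])
    also have "\<dots> \<le> (R + 1 + C) / 1" using t1 R C_nonneg by (intro divide_left_mono) auto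
    finally show ?thesis using that T by (simp add: X_def)
  qed
  show ?thesis
  proof (rule that[OF X(1) T Rep])
    fix lam y y' x n
    assume lam: "norm lam \<le> R" and sol: "is_sol q lam y y'" and x: "X \<le> x" "x \<le> n"
    have pos: "t > 0" "t \<ge> 1" if "t \<ge> X" for t using that X by auto
    note st = backward_stability[of X T "\<zeta> lam y" "\<theta> lam y y'" "\<lambda>t. (D t lam)\<^sup>2" "\<lambda>t. \<tau> t lam"
        "\<lambda>t. norm ((D t lam)\<^sup>2)" "\<lambda>t. 2 * Re (p t lam) * norm ((D t lam)\<^sup>2)" x n,
        OF X T \<zeta>_deriv[OF sol pos(1)] weighted_\<theta>_deriv[OF sol pos(1)] refl _ norm_D_square_deriv[OF pos(1)] _ _ x]
    have e: "2 * Re (p t lam) * norm ((D t lam)\<^sup>2) \<le> - norm ((D t lam)\<^sup>2)" if "X \<le> t" for t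
      using mult_right_mono[of "2 * Re (p t lam)" "-1" "norm ((D t lam)\<^sup>2)"] Rep[OF lam that] by simp
    have tb: "norm (\<tau> t lam) \<le> T / t\<^sup>2" if "X \<le> t" for t
      unfolding T_def by (rule coefficient_bounds(2)[OF R lam pos(2)[OF that]])
    show "norm (\<zeta> lam y x) \<le> 2 * (norm (\<zeta> lam y n) + norm (\<theta> lam y y' n)) \<and>
        norm (\<theta> lam y y' x) \<le> norm (\<theta> lam y y' n) + T * (2 * (norm (\<zeta> lam y n) + norm (\<theta> lam y y' n))) / x\<^sup>2 \<and>
        norm (\<zeta> lam y x - \<zeta> lam y n) \<le> norm (\<theta> lam y y' n) + T * (2 * (norm (\<zeta> lam y n) + norm (\<theta> lam y y' n))) / x"
      by (intro conjI st) (auto intro: e tb)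
  qed
qed

lemma D_holomorphic: "D x holomorphic_on UNIV"
  unfolding D_def[abs_def] L_def by (intro holomorphic_intros) auto

lemma p_holomorphic: "p x holomorphic_on UNIV"
proof -
  have "p x = (\<lambda>lam. (lam - 1) * (1 / (2 * of_real x)) - of_real x + w x)"
    by (auto simp: p_def)
  then show ?thesis by (auto intro!: holomorphic_intros)
qed

text \<open>Solutions started at \<open>m \<ge> n\<close> and at \<open>n\<close> differ at
  \<open>x = n\<close> by \<open>O(1/n)\<close> in \<open>\<zeta>\<close> and
  \<open>\<theta>\<close>. Stability carries this back to a fixed \<open>X\<close>, where the
  coefficients in the entire basis \<open>c\<close>, \<open>s\<close> can be read off; these
  therefore form locally uniform Cauchy sequences of entire functions.\<close>

lemma recessive_solution_exists:
  obtains psi psi' :: "real \<Rightarrow> complex \<Rightarrow> complex"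
  where "\<And>lam. is_sol q lam (\<lambda>x. psi x lam) (\<lambda>x. psi' x lam)"
    and "\<And>x. psi x holomorphic_on UNIV" "\<And>x. psi' x holomorphic_on UNIV"
    and "\<And>R. R \<ge> 0 \<Longrightarrow> \<exists>X\<ge>1. \<exists>B\<ge>0. \<forall>lam x. norm lam \<le> R \<and> x \<ge> X \<longrightarrow>
        norm (\<zeta> lam (\<lambda>x. psi x lam) x - 1) \<le> B / x \<and>
        norm (\<theta> lam (\<lambda>x. psi x lam) (\<lambda>x. psi' x lam) x) \<le> B / x"
proof (rule fundamental_solutions)
  fix c c' s s' :: "real \<Rightarrow> complex \<Rightarrow> complex"
  assume c: "\<And>lam. is_sol q lam (\<lambda>x. c x lam) (\<lambda>x. c' x lam)"
    and s: "\<And>lam. is_sol q lam (\<lambda>x. s x lam) (\<lambda>x. s' x lam)"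
    and wr: "\<And>x lam. c x lam * s' x lam - c' x lam * s x lam = 1"
    and hol: "\<And>x. c x holomorphic_on UNIV" "\<And>x. c' x holomorphic_on UNIV"
      "\<And>x. s x holomorphic_on UNIV" "\<And>x. s' x holomorphic_on UNIV"
  txt \<open>\<open>y n\<close> is the solution with \<open>\<zeta> = 1\<close> and \<open>\<theta> = 0\<close> at \<open>x = n\<close>.\<close>
  define \<alpha> where "\<alpha> n lam = D (real n) lam * s' (real n) lam - p (real n) lam * D (real n) lam * s (real n) lam" for n lam
  define \<beta> where "\<beta> n lam = c (real n) lam * (p (real n) lam * D (real n) lam) - c' (real n) lam * D (real n) lam" for n lam
  define y where "y n lam x = \<alpha> n lam * c x lam + \<beta> n lam * s x lam" for n lam x
  define y' where "y' n lam x = \<alpha> n lam * c' x lam + \<beta> n lam * s' x lam" for n lam x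
  have ysol: "is_sol q lam (y n lam) (y' n lam)" for n lam
    unfolding y_def[abs_def] y'_def[abs_def] by (rule is_sol_lincomb[OF c s])
  have yn: "y n lam (real n) = D (real n) lam" for n lam
  proof -
    have "y n lam (real n) = D (real n) lam * (c (real n) lam * s' (real n) lam - c' (real n) lam * s (real n) lam)"
      by (simp add: y_def \<alpha>_def \<beta>_def algebra_simps)
    then show ?thesis by (simp add: wr)
  qed
  have y'n: "y' n lam (real n) = p (real n) lam * D (real n) lam" for n lam
  proof -
    have "y' n lam (real n) = p (real n) lam * D (real n) lam * (c (real n) lam * s' (real n) lam - c' (real n) lam * s (real n) lam)"
      by (simp add: y'_def \<alpha>_def \<beta>_def algebra_simps)
    then show ?thesis by (simp add: wr)
  qed
  have ze_n: "\<zeta> lam (y n lam) (real n) = 1" and th_n: "\<theta> lam (y n lam) (y' n lam) (real n) = 0" for n lam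
    by (simp_all add: \<zeta>_def \<theta>_def yn y'n)
  have rate: "\<exists>Q X. \<forall>lam n m. norm lam \<le> R \<and> X \<le> real n \<and> n \<le> m \<longrightarrow>
      norm (\<alpha> m lam - \<alpha> n lam) \<le> Q / real n \<and> norm (\<beta> m lam - \<beta> n lam) \<le> Q / real n"
    and near: "\<exists>X\<ge>1. \<exists>B\<ge>0. \<forall>lam x n. norm lam \<le> R \<and> x \<ge> X \<and> x \<le> real n \<longrightarrow>
      norm (\<zeta> lam (y n lam) x - 1) \<le> B / x \<and> norm (\<theta> lam (y n lam) (y' n lam) x) \<le> B / x"
    if R: "R \<ge> 0" for R
  proof (atomize (full), rule solution_stability[OF R])
    fix X T :: real
    assume X: "X \<ge> 1" and T: "T \<ge> 0"
      and st: "\<And>lam y y' x n. norm lam \<le> R \<Longrightarrow> is_sol q lam y y' \<Longrightarrow> X \<le> x \<Longrightarrow> x \<le> n \<Longrightarrow>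
        norm (\<zeta> lam y x) \<le> 2 * (norm (\<zeta> lam y n) + norm (\<theta> lam y y' n)) \<and>
        norm (\<theta> lam y y' x) \<le> norm (\<theta> lam y y' n) + T * (2 * (norm (\<zeta> lam y n) + norm (\<theta> lam y y' n))) / x\<^sup>2 \<and>
        norm (\<zeta> lam y x - \<zeta> lam y n) \<le> norm (\<theta> lam y y' n) + T * (2 * (norm (\<zeta> lam y n) + norm (\<theta> lam y y' n))) / x"
    \<comment> \<open>With \<open>\<zeta> = 1\<close> and \<open>\<theta> = 0\<close> at
      \<open>n\<close>, the constant \<open>B\<close> of backward stability is 2.\<close>
    have near': "norm (\<zeta> lam (y n lam) x - 1) \<le> 2 * T / x \<and> norm (\<theta> lam (y n lam) (y' n lam) x) \<le> 2 * T / x"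
      if "norm lam \<le> R" "x \<ge> X" "x \<le> real n" for lam x n
    proof -
      have "x\<^sup>2 \<ge> x" "x > 0" using self_le_power[of x 2] that X by auto
      then have "2 * T / x\<^sup>2 \<le> 2 * T / x" using T by (intro divide_left_mono) auto
      with st[OF that(1) ysol[of lam n] that(2,3)] show ?thesis
        by (simp add: ze_n th_n mult.commute)
    qed
    have bd: "\<exists>K. \<forall>lam. norm lam \<le> R \<longrightarrow> norm (f lam) \<le> K" if "f holomorphic_on UNIV" for f :: "complex \<Rightarrow> complex"
    proof -
      have "bounded (f ` cball 0 R)"
        by (intro compact_imp_bounded compact_continuous_image holomorphic_on_imp_continuous_on
            holomorphic_on_subset[OF that]) auto
      then obtain K where "\<forall>lam\<in>cball 0 R. norm (f lam) \<le> K" by (auto simp: bounded_iff)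
      then show ?thesis by (intro exI[of _ K]) simp
    qed
    obtain KD where KD: "\<And>lam. norm lam \<le> R \<Longrightarrow> norm (D X lam) \<le> KD"
      using bd[OF D_holomorphic[of X]] by blast
    obtain Kp where Kp: "\<And>lam. norm lam \<le> R \<Longrightarrow> norm (p X lam) \<le> Kp"
      using bd[OF p_holomorphic[of X]] by blast
    obtain Kc Kc' where Kc: "\<And>lam. norm lam \<le> R \<Longrightarrow> norm (c X lam) \<le> Kc"
        "\<And>lam. norm lam \<le> R \<Longrightarrow> norm (c' X lam) \<le> Kc'"
      using bd[OF hol(1)[of X]] bd[OF hol(2)[of X]] by blast
    obtain Ks Ks' where Ks: "\<And>lam. norm lam \<le> R \<Longrightarrow> norm (s X lam) \<le> Ks"
        "\<And>lam. norm lam \<le> R \<Longrightarrow> norm (s' X lam) \<le> Ks'"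
      using bd[OF hol(3)[of X]] bd[OF hol(4)[of X]] by blast
    note K = KD Kp Kc Ks
    \<comment> \<open>\<open>U / n\<close> and \<open>V / n\<close> bound \<open>\<zeta>\<close> and
      \<open>\<theta>\<close> of the difference at \<open>X\<close>; \<open>U\<close> is
      \<open>2 * (2 T + 2 T)\<close> because both are at most \<open>2 T / n\<close> at
      \<open>x = n\<close>. \<open>Q\<close> adds the contributions to both coefficients, so that
      one constant serves \<open>\<alpha>\<close> and \<open>\<beta>\<close>.\<close>
    define U where "U = 8 * T"
    define V where "V = 2 * T + T * U"
    define Q where "Q = KD * U * (Ks' + Kc') + KD * (V + Kp * U) * (Ks + Kc)"
    have UV: "U \<ge> 0" "V \<ge> 0" using T by (auto simp: U_def V_def)
    have "norm (\<alpha> m lam - \<alpha> n lam) \<le> Q / real n \<and> norm (\<beta> m lam - \<beta> n lam) \<le> Q / real n"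
      if lam: "norm lam \<le> R" and nX: "X \<le> real n" and nm: "n \<le> m" for lam n m
    proof -
      define a where "a = \<alpha> m lam - \<alpha> n lam"
      define b where "b = \<beta> m lam - \<beta> n lam"
      define d where "d x = a * c x lam + b * s x lam" for x
      define d' where "d' x = a * c' x lam + b * s' x lam" for x
      have dsol: "is_sol q lam d d'"
        unfolding d_def[abs_def] d'_def[abs_def] by (rule is_sol_lincomb[OF c s])
      have dy: "d x = y m lam x - y n lam x" "d' x = y' m lam x - y' n lam x" for x
        by (simp_all add: d_def d'_def y_def y'_def a_def b_def algebra_simps)
      have zd: "\<zeta> lam d x = \<zeta> lam (y m lam) x - \<zeta> lam (y n lam) x"
        and td: "\<theta> lam d d' x = \<theta> lam (y m lam) (y' m lam) x - \<theta> lam (y n lam) (y' n lam) x" for x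
        by (simp_all add: \<zeta>_def \<theta>_def dy diff_divide_distrib add_divide_distrib algebra_simps)
      have n0: "real n > 0" using X nX by linarith
      have dn: "norm (\<zeta> lam d (real n)) \<le> 2 * T / real n" "norm (\<theta> lam d d' (real n)) \<le> 2 * T / real n"
        using near'[OF lam nX, of m] nm by (auto simp: zd td ze_n th_n)
      from st[OF lam dsol order_refl nX]
      have 1: "norm (\<zeta> lam d X) \<le> 2 * (norm (\<zeta> lam d (real n)) + norm (\<theta> lam d d' (real n)))"
        and 2: "norm (\<theta> lam d d' X) \<le> norm (\<theta> lam d d' (real n)) + T * (2 * (norm (\<zeta> lam d (real n)) + norm (\<theta> lam d d' (real n)))) / X\<^sup>2"
        by auto
      have 3: "2 * (norm (\<zeta> lam d (real n)) + norm (\<theta> lam d d' (real n))) \<le> U / real n"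
        using dn n0 by (simp add: U_def field_simps)
      have zX: "norm (\<zeta> lam d X) \<le> U / real n" using 1 3 by linarith
      have K0: "0 \<le> KD" "0 \<le> Kp" "0 \<le> Kc" "0 \<le> Kc'" "0 \<le> Ks" "0 \<le> Ks'"
        by (rule order_trans[OF norm_ge_zero K(1)[OF lam]] order_trans[OF norm_ge_zero K(2)[OF lam]]
            order_trans[OF norm_ge_zero K(3)[OF lam]] order_trans[OF norm_ge_zero K(4)[OF lam]]
            order_trans[OF norm_ge_zero K(5)[OF lam]] order_trans[OF norm_ge_zero K(6)[OF lam]])+
      have tX: "norm (\<theta> lam d d' X) \<le> V / real n"
      proof -
        have "T * (2 * (norm (\<zeta> lam d (real n)) + norm (\<theta> lam d d' (real n)))) / X\<^sup>2 \<le> T * (U / real n) / 1"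
          using T X 3 UV n0 by (intro frac_le mult_left_mono) auto
        with 2 dn(2) show ?thesis by (simp add: V_def add_divide_distrib)
      qed
      have dX: "norm (d X) \<le> KD * (U / real n)"
      proof -
        have "norm (d X) = norm (D X lam) * norm (\<zeta> lam d X)" by (simp add: \<zeta>_def norm_divide)
        also have "\<dots> \<le> KD * (U / real n)"
          by (intro mult_mono K lam zX) (use K(1)[OF lam] order_trans[OF norm_ge_zero] in auto)
        finally show ?thesis .
      qed
      have d'X: "norm (d' X) \<le> KD * ((V + Kp * U) / real n)"
      proof -
        have "d' X = D X lam * (\<theta> lam d d' X + p X lam * \<zeta> lam d X)"
          by (simp add: \<theta>_def \<zeta>_def algebra_simps diff_divide_distrib)
        then have "norm (d' X) = norm (D X lam) * norm (\<theta> lam d d' X + p X lam * \<zeta> lam d X)"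
          by (simp add: norm_mult)
        also have "\<dots> \<le> KD * (V / real n + Kp * (U / real n))"
        proof (intro mult_mono K lam order_trans[OF norm_triangle_ineq] add_mono tX)
          show "norm (p X lam * \<zeta> lam d X) \<le> Kp * (U / real n)"
            unfolding norm_mult by (intro mult_mono K lam zX K0) auto
        qed (use K0 in auto)
        finally show ?thesis by (simp add: add_divide_distrib)
      qed
      \<comment> \<open>The coefficients are the Wronskians of \<open>d\<close> with the basis,
        whose own Wronskian is 1.\<close>
      have ab: "a = d X * s' X lam - d' X * s X lam" "b = c X lam * d' X - c' X lam * d X"
      proof -
        have "d X * s' X lam - d' X * s X lam = a * (c X lam * s' X lam - c' X lam * s X lam)"
             "c X lam * d' X - c' X lam * d X = b * (c X lam * s' X lam - c' X lam * s X lam)"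
          by (simp_all add: d_def d'_def algebra_simps)
        then show "a = d X * s' X lam - d' X * s X lam" "b = c X lam * d' X - c' X lam * d X"
          by (simp_all add: wr)
      qed
      have M: "0 \<le> KD * (U / real n)" "0 \<le> KD * ((V + Kp * U) / real n)"
        using K0 UV n0 by auto
      have "norm a \<le> norm (d X) * norm (s' X lam) + norm (d' X) * norm (s X lam)"
        unfolding ab using norm_triangle_ineq4[of "d X * s' X lam" "d' X * s X lam"] by (simp only: norm_mult)
      also have "\<dots> \<le> KD * (U / real n) * Ks' + KD * ((V + Kp * U) / real n) * Ks"
        by (intro add_mono mult_mono dX d'X K lam M) auto
      also have "\<dots> \<le> KD * (U / real n) * (Ks' + Kc') + KD * ((V + Kp * U) / real n) * (Ks + Kc)"
        using M K0 by (intro add_mono mult_left_mono) auto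
      also have "\<dots> = Q / real n" using n0 by (simp add: Q_def field_simps)
      finally have A: "norm a \<le> Q / real n" .
      have "norm b \<le> norm (d' X) * norm (c X lam) + norm (d X) * norm (c' X lam)"
        unfolding ab using norm_triangle_ineq4[of "c X lam * d' X" "c' X lam * d X"]
        by (simp only: norm_mult mult.commute)
      also have "\<dots> \<le> KD * ((V + Kp * U) / real n) * Kc + KD * (U / real n) * Kc'"
        by (intro add_mono mult_mono dX d'X K lam M) auto
      also have "\<dots> \<le> KD * ((V + Kp * U) / real n) * (Ks + Kc) + KD * (U / real n) * (Ks' + Kc')"
        using M K0 by (intro add_mono mult_left_mono) auto
      also have "\<dots> = Q / real n" using n0 by (simp add: Q_def field_simps)
      finally have B: "norm b \<le> Q / real n" .
      from A B show ?thesis by (simp add: a_def b_def)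
    qed
    moreover have "0 \<le> 2 * T" using T by simp
    ultimately show "(\<exists>Q X. \<forall>lam n m. norm lam \<le> R \<and> X \<le> real n \<and> n \<le> m \<longrightarrow>
        norm (\<alpha> m lam - \<alpha> n lam) \<le> Q / real n \<and> norm (\<beta> m lam - \<beta> n lam) \<le> Q / real n) \<and>
      (\<exists>X\<ge>1. \<exists>B\<ge>0. \<forall>lam x n. norm lam \<le> R \<and> x \<ge> X \<and> x \<le> real n \<longrightarrow>
        norm (\<zeta> lam (y n lam) x - 1) \<le> B / x \<and> norm (\<theta> lam (y n lam) (y' n lam) x) \<le> B / x)"
      using X near' by meson
  qed
  have hol\<alpha>: "\<alpha> n holomorphic_on UNIV" and hol\<beta>: "\<beta> n holomorphic_on UNIV" for n
    unfolding \<alpha>_def[abs_def] \<beta>_def[abs_def]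
    by (intro holomorphic_on_diff holomorphic_on_mult hol D_holomorphic p_holomorphic)+
  obtain a where a: "a holomorphic_on UNIV" "\<And>lam. (\<lambda>n. \<alpha> n lam) \<longlonglongrightarrow> a lam"
    by (rule holomorphic_limit_of_rate[of \<alpha>, OF hol\<alpha>]) (use rate in meson)+
  obtain b where b: "b holomorphic_on UNIV" "\<And>lam. (\<lambda>n. \<beta> n lam) \<longlonglongrightarrow> b lam"
    by (rule holomorphic_limit_of_rate[of \<beta>, OF hol\<beta>]) (use rate in meson)+
  define psi where "psi x lam = a lam * c x lam + b lam * s x lam" for x lam
  define psi' where "psi' x lam = a lam * c' x lam + b lam * s' x lam" for x lam
  show thesis
  proof (rule that[of psi psi'])
    show "is_sol q lam (\<lambda>x. psi x lam) (\<lambda>x. psi' x lam)" for lam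
      unfolding psi_def psi'_def by (rule is_sol_lincomb[OF c s])
    show "psi x holomorphic_on UNIV" "psi' x holomorphic_on UNIV" for x
      unfolding psi_def[abs_def] psi'_def[abs_def]
      by (intro holomorphic_on_add holomorphic_on_mult a b hol)+
    fix R :: real assume R: "R \<ge> 0"
    obtain X B where X: "X \<ge> 1" and B: "B \<ge> 0"
      and nr: "\<And>lam x n. norm lam \<le> R \<Longrightarrow> x \<ge> X \<Longrightarrow> x \<le> real n \<Longrightarrow>
        norm (\<zeta> lam (y n lam) x - 1) \<le> B / x \<and> norm (\<theta> lam (y n lam) (y' n lam) x) \<le> B / x"
      using near[OF R] by meson
    have "norm (\<zeta> lam (\<lambda>x. psi x lam) x - 1) \<le> B / x \<and>
        norm (\<theta> lam (\<lambda>x. psi x lam) (\<lambda>x. psi' x lam) x) \<le> B / x"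
      if lam: "norm lam \<le> R" and x: "x \<ge> X" for lam x
    proof -
      \<comment> \<open>At fixed \<open>x\<close> the bounds hold for all large \<open>n\<close>
        with the same \<open>B\<close>, hence in the limit.\<close>
      have ev: "\<forall>\<^sub>F n in sequentially. x \<le> real n"
        using filterlim_real_sequentially unfolding filterlim_at_top by blast
      have yl: "(\<lambda>n. y n lam x) \<longlonglongrightarrow> psi x lam" "(\<lambda>n. y' n lam x) \<longlonglongrightarrow> psi' x lam"
        unfolding y_def y'_def psi_def psi'_def by (intro tendsto_intros a b)+
      have zl: "(\<lambda>n. \<zeta> lam (y n lam) x) \<longlonglongrightarrow> \<zeta> lam (\<lambda>x. psi x lam) x"
        "(\<lambda>n. \<theta> lam (y n lam) (y' n lam) x) \<longlonglongrightarrow> \<theta> lam (\<lambda>x. psi x lam) (\<lambda>x. psi' x lam) x"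
        unfolding \<zeta>_def \<theta>_def by (intro tendsto_intros yl; simp)+
      have lims: "(\<lambda>n. norm (\<zeta> lam (y n lam) x - 1)) \<longlonglongrightarrow> norm (\<zeta> lam (\<lambda>x. psi x lam) x - 1)"
        "(\<lambda>n. norm (\<theta> lam (y n lam) (y' n lam) x)) \<longlonglongrightarrow> norm (\<theta> lam (\<lambda>x. psi x lam) (\<lambda>x. psi' x lam) x)"
        by (intro tendsto_intros zl)+
      show ?thesis
        by (intro conjI tendsto_upperbound[OF lims(1)] tendsto_upperbound[OF lims(2)] eventually_mono[OF ev])
          (use nr[OF lam x] in auto)
    qed
    with X B show "\<exists>X\<ge>1. \<exists>B\<ge>0. \<forall>lam x. norm lam \<le> R \<and> x \<ge> X \<longrightarrow>
        norm (\<zeta> lam (\<lambda>x. psi x lam) x - 1) \<le> B / x \<and>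
        norm (\<theta> lam (\<lambda>x. psi x lam) (\<lambda>x. psi' x lam) x) \<le> B / x"
      by blast
  qed
qed

end

subsection \<open>Asymptotics, uniqueness and simplicity of eigenvalues\<close>

context corrected_potential
begin

text \<open>\<open>psi / Aplus = \<zeta> exp W\<close> and \<open>psi' / (- x Aplus) = exp W (- (p /
  x) \<zeta> - \<theta> / x)\<close>. Every ingredient converges uniformly on compact sets, since
  \<open>p\<close> is \<open>- x\<close> up to \<open>O(1/x)\<close>.\<close>

lemma uniform_asymptotics:
  assumes rate: "\<And>R. R \<ge> 0 \<Longrightarrow> \<exists>X\<ge>1. \<exists>B\<ge>0. \<forall>lam x. norm lam \<le> R \<and> x \<ge> X \<longrightarrow>
        norm (\<zeta> lam (\<lambda>x. psi x lam) x - 1) \<le> B / x \<and>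
        norm (\<theta> lam (\<lambda>x. psi x lam) (\<lambda>x. psi' x lam) x) \<le> B / x"
    and K: "compact K"
  shows "uniform_limit K (\<lambda>x lam. psi x lam / Aplus x lam) (\<lambda>_. 1) at_top"
    and "uniform_limit K (\<lambda>x lam. psi' x lam / (- of_real x * Aplus x lam)) (\<lambda>_. 1) at_top"
proof -
  obtain R0 where "\<And>lam. lam \<in> K \<Longrightarrow> norm lam \<le> R0"
    using compact_imp_bounded[OF K] by (auto simp: bounded_iff)
  then obtain R where R: "R \<ge> 0" "\<And>lam. lam \<in> K \<Longrightarrow> norm lam \<le> R"
    using that[of "max 0 R0"] by (meson max.cobounded1 max.coboundedI2)
  obtain X B where X: "X \<ge> 1" and B: "B \<ge> 0" and b: "\<And>lam x. norm lam \<le> R \<Longrightarrow> x \<ge> X \<Longrightarrow>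
        norm (\<zeta> lam (\<lambda>x. psi x lam) x - 1) \<le> B / x \<and>
        norm (\<theta> lam (\<lambda>x. psi x lam) (\<lambda>x. psi' x lam) x) \<le> B / x"
    using rate[OF R(1)] by meson
  have shrink: "a / x \<le> k / x" if "a \<le> k / x" "x \<ge> X" "k \<ge> 0" for a k x :: real
  proof -
    have "x \<ge> 1" using that X by simp
    then have "k / x \<le> k / 1" using that by (intro divide_left_mono) auto
    then show ?thesis using that \<open>x \<ge> 1\<close> by (intro divide_right_mono) auto
  qed
  have U1: "uniform_limit K (\<lambda>x lam. \<zeta> lam (\<lambda>x. psi x lam) x) (\<lambda>_. 1) at_top"
    by (rule uniform_limit_at_top_of_rate[of X _ _ _ B]) (use b R in auto)
  have U2: "uniform_limit K (\<lambda>x lam. \<theta> lam (\<lambda>x. psi x lam) (\<lambda>x. psi' x lam) x / of_real x) (\<lambda>_. 0) at_top"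
  proof (rule uniform_limit_at_top_of_rate[of X _ _ _ B])
    fix x lam assume x: "x \<ge> X" and "lam \<in> K"
    then have "norm (\<theta> lam (\<lambda>x. psi x lam) (\<lambda>x. psi' x lam) x) \<le> B / x" using b R by blast
    from shrink[OF this x B] x X
    show "norm (\<theta> lam (\<lambda>x. psi x lam) (\<lambda>x. psi' x lam) x / of_real x - 0) \<le> B / x"
      by (simp add: norm_divide)
  qed
  have U3: "uniform_limit K (\<lambda>x lam. - p x lam / of_real x) (\<lambda>_. 1) at_top"
  proof (rule uniform_limit_at_top_of_rate[of X _ _ _ "R + 1 + C"])
    fix x lam assume x: "x \<ge> X" and "lam \<in> K"
    then have "norm (p x lam + of_real x) \<le> (R + 1 + C) / x" using X R by (intro coefficient_bounds) auto
    then have "norm (p x lam + of_real x) / x \<le> (R + 1 + C) / x"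
      using R C_nonneg by (intro shrink x) auto
    moreover have "- p x lam / of_real x - 1 = - ((p x lam + of_real x) / of_real x)"
      using x X by (simp add: field_simps)
    ultimately show "norm (- p x lam / of_real x - 1) \<le> (R + 1 + C) / x"
      using x X by (simp only: norm_minus_cancel) (simp add: norm_divide)
  qed
  have UW: "uniform_limit K (\<lambda>x lam. exp (W x)) (\<lambda>_. 1) at_top"
  proof (rule uniform_limitI)
    fix e :: real assume e: "e > 0"
    have "((\<lambda>x. exp (W x)) \<longlongrightarrow> exp 0) at_top" by (intro tendsto_intros W_lim)
    from tendstoD[OF this e] show "\<forall>\<^sub>F x in at_top. \<forall>lam\<in>K. dist (exp (W x)) 1 < e"
      by (auto elim: eventually_mono)
  qed
  have bb: "bounded ((\<lambda>_. z) ` K)" for z :: complex by (auto intro!: finite_imp_bounded finite_subset[of _ "{z}"])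
  have pos: "\<forall>\<^sub>F x in at_top. x > (0::real)" by (rule eventually_gt_at_top)
  have A: "Aplus x lam = D x lam / exp (W x)" if "x > 0" for x lam
    using D_eq_Aplus[OF that, of lam] by simp
  have "uniform_limit K (\<lambda>x lam. \<zeta> lam (\<lambda>x. psi x lam) x * exp (W x)) (\<lambda>_. 1 * 1) at_top"
    by (intro uniform_lim_mult U1 UW bb)
  then show "uniform_limit K (\<lambda>x lam. psi x lam / Aplus x lam) (\<lambda>_. 1) at_top"
  proof (rule uniform_limit_cong[THEN iffD1, rotated -1])
    show "\<forall>\<^sub>F x in at_top. \<forall>lam\<in>K. \<zeta> lam (\<lambda>x. psi x lam) x * exp (W x) = psi x lam / Aplus x lam"
      using pos by eventually_elim (simp add: A \<zeta>_def)
  qed auto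
  have "uniform_limit K (\<lambda>x lam. exp (W x) * ((- p x lam / of_real x) * \<zeta> lam (\<lambda>x. psi x lam) x
      - \<theta> lam (\<lambda>x. psi x lam) (\<lambda>x. psi' x lam) x / of_real x)) (\<lambda>_. 1 * (1 * 1 - 0)) at_top"
    by (intro uniform_lim_mult uniform_limit_minus U1 U2 U3 UW bb)
  then show "uniform_limit K (\<lambda>x lam. psi' x lam / (- of_real x * Aplus x lam)) (\<lambda>_. 1) at_top"
  proof (rule uniform_limit_cong[THEN iffD1, rotated -1])
    show "\<forall>\<^sub>F x in at_top. \<forall>lam\<in>K. exp (W x) * ((- p x lam / of_real x) * \<zeta> lam (\<lambda>x. psi x lam) x
      - \<theta> lam (\<lambda>x. psi x lam) (\<lambda>x. psi' x lam) x / of_real x) = psi' x lam / (- of_real x * Aplus x lam)"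
      using pos by eventually_elim (simp add: A \<zeta>_def \<theta>_def field_simps)
  qed auto
qed

text \<open>In the uniqueness proof the Wronskian of two candidates is \<open>- x D\<^sup>2\<close>
  times a function tending to 0, so this prefactor must stay bounded. That holds because
  \<open>|D\<^sup>2| exp x\<close> is eventually nonincreasing and
  \<open>x \<le> exp x\<close>.\<close>

lemma x_times_D_square_bounded:
  obtains X B where "\<And>x. x \<ge> X \<Longrightarrow> x * norm ((D x lam)\<^sup>2) \<le> B"
proof (rule solution_stability[of "norm lam"])
  fix X T :: real
  assume X: "X \<ge> 1" and Re: "\<And>lam' t. norm lam' \<le> norm lam \<Longrightarrow> t \<ge> X \<Longrightarrow> Re (p t lam') \<le> - 1 / 2"
  let ?e = "\<lambda>x. norm ((D x lam)\<^sup>2)"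
  have "x * ?e x \<le> ?e X * exp X" if x: "x \<ge> X" for x
  proof -
    have "?e x * exp x \<le> ?e X * exp X"
    proof (rule DERIV_nonpos_imp_nonincreasing[OF x])
      fix t assume t: "X \<le> t"
      have "((\<lambda>t. ?e t * exp t) has_real_derivative (2 * Re (p t lam) * ?e t) * exp t + exp t * ?e t) (at t)"
        using t X by (intro DERIV_mult norm_D_square_deriv DERIV_exp) auto
      moreover have "(2 * Re (p t lam) * ?e t) * exp t + exp t * ?e t = (2 * Re (p t lam) + 1) * (?e t * exp t)"
        by (simp add: algebra_simps)
      moreover have "\<dots> \<le> 0"
        using Re[OF order_refl t] by (intro mult_nonpos_nonneg) auto
      ultimately show "\<exists>y. ((\<lambda>t. ?e t * exp t) has_real_derivative y) (at t) \<and> y \<le> 0" by auto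
    qed
    then have "exp x * ?e x \<le> ?e X * exp X" by (subst mult.commute)
    moreover have "x * ?e x \<le> exp x * ?e x"
    proof (rule mult_right_mono)
      show "x \<le> exp x" using exp_ge_add_one_self[of x] by linarith
    qed auto
    ultimately show ?thesis by (rule order_trans[rotated])
  qed
  then show thesis by (rule that)
qed auto

text \<open>The candidates share their leading behaviour, so the leading terms of the constant
  Wronskian cancel and the rest tends to 0. Proportionality follows, and the normalised asymptotics
  fix the factor at 1.\<close>

lemma recessive_solution_unique:
  assumes y: "is_sol q lam y y'" and z: "is_sol q lam z z'"
    and ly: "((\<lambda>x. y x / Aplus x lam) \<longlongrightarrow> 1) at_top" "((\<lambda>x. y' x / (- of_real x * Aplus x lam)) \<longlongrightarrow> 1) at_top"
    and lz: "((\<lambda>x. z x / Aplus x lam) \<longlongrightarrow> 1) at_top" "((\<lambda>x. z' x / (- of_real x * Aplus x lam)) \<longlongrightarrow> 1) at_top"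
  shows "y = z"
proof -
  define k where "k = z 0 * y' 0 - z' 0 * y 0"
  have k: "k = z x * y' x - z' x * y x" for x
    unfolding k_def by (rule wronskian_const[OF z y])
  obtain X B where XB: "\<And>x. x \<ge> X \<Longrightarrow> x * norm ((D x lam)\<^sup>2) \<le> B"
    using x_times_D_square_bounded[of lam] by blast
  define g where "g x = (exp (- W x))\<^sup>2 * ((z x / Aplus x lam) * (y' x / (- of_real x * Aplus x lam))
     - (z' x / (- of_real x * Aplus x lam)) * (y x / Aplus x lam))" for x
  have "(g \<longlongrightarrow> (exp (- 0))\<^sup>2 * (1 * 1 - 1 * 1)) at_top"
    unfolding g_def[abs_def] by (intro tendsto_intros ly lz W_lim)
  then have "(g \<longlongrightarrow> 0) at_top" by simp
  then have Bg: "((\<lambda>x. B * norm (g x)) \<longlongrightarrow> 0) at_top"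
    by (intro tendsto_mult_right_zero tendsto_norm_zero)
  have ev: "\<forall>\<^sub>F x in at_top. norm k \<le> B * norm (g x)"
    using eventually_gt_at_top[of "max X 0"]
  proof eventually_elim
    case (elim x)
    then have x: "x > 0" "x \<ge> X" by auto
    have A: "D x lam = Aplus x lam * exp (W x)" by (rule D_eq_Aplus[OF x(1)])
    then have A0: "Aplus x lam \<noteq> 0" using D_nonzero[of x lam] by auto
    have "(D x lam)\<^sup>2 * (exp (- W x))\<^sup>2 = (Aplus x lam)\<^sup>2"
      by (simp add: A exp_minus field_simps)
    moreover have "z x * y' x - z' x * y x = - of_real x * (Aplus x lam)\<^sup>2 *
       ((z x / Aplus x lam) * (y' x / (- of_real x * Aplus x lam))
     - (z' x / (- of_real x * Aplus x lam)) * (y x / Aplus x lam))"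
      using A0 x by (simp add: field_simps power2_eq_square)
    ultimately have "k = - of_real x * (D x lam)\<^sup>2 * g x"
      by (simp add: k[of x] g_def)
    then have "norm k = (x * norm ((D x lam)\<^sup>2)) * norm (g x)"
      using x by (simp add: norm_mult)
    also have "\<dots> \<le> B * norm (g x)" by (intro mult_right_mono XB x) auto
    finally show ?case .
  qed
  have "((\<lambda>x::real. k) \<longlongrightarrow> 0) at_top"
    by (rule Lim_null_comparison[OF ev Bg])
  then have k0: "k = 0"
    using tendsto_unique[OF trivial_limit_at_top_linorder _ tendsto_const] by blast
  have "\<forall>\<^sub>F x in at_top. z x / Aplus x lam \<noteq> 0"
    by (rule tendsto_imp_eventually_ne[OF lz(1)]) auto
  then obtain x0 where x0: "z x0 \<noteq> 0"
    by (metis (mono_tags) div_0 eventually_at_top_linorder order_refl)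
  define \<kappa> where "\<kappa> = y x0 / z x0"
  have yz: "y = (\<lambda>x. \<kappa> * z x)"
    unfolding \<kappa>_def by (rule wronskian_zero_imp_proportional[OF z y _ x0, of 0]) (use k0 k_def in auto)
  have "((\<lambda>x. \<kappa> * (z x / Aplus x lam)) \<longlongrightarrow> \<kappa> * 1) at_top" by (intro tendsto_intros lz)
  then have "((\<lambda>x. y x / Aplus x lam) \<longlongrightarrow> \<kappa>) at_top" by (simp add: yz)
  then have "\<kappa> = 1" using tendsto_unique[OF trivial_limit_at_top_linorder _ ly(1)] by blast
  with yz show ?thesis by simp
qed

end

context bounded_potential
begin

text \<open>Collected in terms of \<open>q\<close> alone, free of \<open>w\<close> and
  \<open>W\<close>, so that it applies to the reflected potential too.\<close>

lemma recessive_solution_at_top: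
  "\<exists>psi psi' :: real \<Rightarrow> complex \<Rightarrow> complex.
    (\<forall>lam. is_sol q lam (\<lambda>x. psi x lam) (\<lambda>x. psi' x lam)) \<and>
    (\<forall>K. compact K \<longrightarrow>
       uniform_limit K (\<lambda>x lam. psi x lam / Aplus x lam) (\<lambda>_. 1) at_top \<and>
       uniform_limit K (\<lambda>x lam. psi' x lam / (- of_real x * Aplus x lam)) (\<lambda>_. 1) at_top) \<and>
    (\<forall>lam y y'. is_sol q lam y y' \<and>
       ((\<lambda>x. y x / Aplus x lam) \<longlongrightarrow> 1) at_top \<and>
       ((\<lambda>x. y' x / (- of_real x * Aplus x lam)) \<longlongrightarrow> 1) at_top
       \<longrightarrow> y = (\<lambda>x. psi x lam)) \<and>
    (\<forall>x. psi x holomorphic_on UNIV \<and> psi' x holomorphic_on UNIV)"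
proof (rule correction_exponent)
  fix w W :: "real \<Rightarrow> complex"
  assume "\<And>x. x \<ge> 1 \<Longrightarrow> norm (w x) \<le> C / x"
    and "\<And>x. ((\<lambda>x. w x - q1 x) has_vector_derivative of_real (2 * x) * w x) (at x)"
    and "\<And>x. (W has_vector_derivative w x) (at x)"
    and "(W \<longlongrightarrow> 0) at_top"
  then interpret corrected_potential q q1 C w W by unfold_locales
  show ?thesis
  proof (rule recessive_solution_exists)
    fix psi psi' :: "real \<Rightarrow> complex \<Rightarrow> complex"
    assume sol: "\<And>lam. is_sol q lam (\<lambda>x. psi x lam) (\<lambda>x. psi' x lam)"
      and hol: "\<And>x. psi x holomorphic_on UNIV" "\<And>x. psi' x holomorphic_on UNIV"
      and rate: "\<And>R. R \<ge> 0 \<Longrightarrow> \<exists>X\<ge>1. \<exists>B\<ge>0. \<forall>lam x. norm lam \<le> R \<and> x \<ge> X \<longrightarrow>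
        norm (\<zeta> lam (\<lambda>x. psi x lam) x - 1) \<le> B / x \<and>
        norm (\<theta> lam (\<lambda>x. psi x lam) (\<lambda>x. psi' x lam) x) \<le> B / x"
    note ul = uniform_asymptotics[of psi psi', OF rate]
    have uniq: "y = (\<lambda>x. psi x lam)"
      if "is_sol q lam y y'" "((\<lambda>x. y x / Aplus x lam) \<longlongrightarrow> 1) at_top"
        "((\<lambda>x. y' x / (- of_real x * Aplus x lam)) \<longlongrightarrow> 1) at_top" for lam y y'
    proof (rule recessive_solution_unique[OF that(1) sol that(2,3)])
      show "((\<lambda>x. psi x lam / Aplus x lam) \<longlongrightarrow> 1) at_top"
        by (rule tendsto_uniform_limitI[OF ul(1)[of "{lam}"]]) auto
      show "((\<lambda>x. psi' x lam / (- of_real x * Aplus x lam)) \<longlongrightarrow> 1) at_top"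
        by (rule tendsto_uniform_limitI[OF ul(2)[of "{lam}"]]) auto
    qed
    show ?thesis
      by (intro exI[of _ psi] exI[of _ psi'] conjI allI impI;
          (rule sol hol | (rule ul, assumption) | (elim conjE, rule uniq, assumption+)))
  qed
qed

text \<open>The energy identity, formally the real part of
  \<open>(f' cnj f)' = f'' cnj f + |f'|\<^sup>2\<close> integrated. On \<open>{a..b}\<close>,
  \<open>f'\<close> is the indefinite integral of a bounded measurable function, so integration by
  parts is available.\<close>

lemma is_sol_mult_cnj:
  assumes f: "is_sol q lam f f'" and ab: "a \<le> b"
  shows "((\<lambda>t. (t\<^sup>2 + Re (q t) - Re lam) * (norm (f t))\<^sup>2 + (norm (f' t))\<^sup>2) has_integral
    Re (f' b * cnj (f b)) - Re (f' a * cnj (f a))) {a..b}"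
proof -
  let ?V = "\<lambda>t. complex_of_real (t\<^sup>2) + q t - lam"
  have fd: "\<And>x. (f has_vector_derivative f' x) (at x)" using f by (simp add: is_sol_def)
  have fc: "continuous_on A f" for A by (rule is_sol_continuous[OF f])
  have f'c: "continuous_on A f'" for A by (rule is_sol_derivative_continuous[OF f])
  have "bounded ((\<lambda>t. (of_real (t\<^sup>2) - lam) * f t) ` {a..b})" "bounded (f ` {a..b})"
    by (intro compact_imp_bounded compact_continuous_image continuous_intros fc compact_Icc)+
  then obtain K1 K2 where K: "\<forall>t\<in>{a..b}. norm ((of_real (t\<^sup>2) - lam) * f t) \<le> K1" "\<forall>t\<in>{a..b}. norm (f t) \<le> K2"
    unfolding bounded_iff by blast
  have bnd: "norm (?V t * f t) \<le> K1 + C * K2" if "t \<in> {a..b}" for t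
  proof -
    have "?V t * f t = (of_real (t\<^sup>2) - lam) * f t + q t * f t" by (simp add: algebra_simps)
    also have "norm \<dots> \<le> norm ((of_real (t\<^sup>2) - lam) * f t) + norm (q t) * norm (f t)"
      by (rule order_trans[OF norm_triangle_ineq]) (simp add: norm_mult)
    also have "\<dots> \<le> K1 + C * K2"
      using K that by (intro add_mono mult_mono q_bound C_nonneg) auto
    finally show ?thesis .
  qed
  have [measurable]: "f \<in> borel_measurable borel" by (rule borel_measurable_continuous_onI[OF fc])
  have [measurable]: "q \<in> borel_measurable borel" by (rule q_measurable)
  have meas: "(\<lambda>t. ?V t * f t) \<in> borel_measurable borel" by measurable
  have "((\<lambda>t. (?V t * f t) * cnj (f t) + f' t * cnj (f' t)) has_integral f' b * cnj (f b) - f' a * cnj (f a)) {a..b}"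
  proof (rule has_integral_mult_indefinite[OF ab meas bnd])
    show "((\<lambda>t. ?V t * f t) has_integral f' y - f' x) {x..y}" if "x \<le> y" for x y
      using f that by (simp add: is_sol_def)
    show "((\<lambda>t. cnj (f t)) has_vector_derivative cnj (f' t)) (at t within {a..b})" for t
      using bounded_linear.has_vector_derivative[OF bounded_linear_cnj fd] has_vector_derivative_at_within by blast
    show "continuous_on {a..b} (\<lambda>t. cnj (f' t))" by (intro continuous_intros f'c)
  qed auto
  from has_integral_linear[OF this bounded_linear_Re]
  have "((\<lambda>t. Re ((?V t * f t) * cnj (f t) + f' t * cnj (f' t))) has_integral
      Re (f' b * cnj (f b) - f' a * cnj (f a))) {a..b}" by (simp add: o_def)
  moreover have "Re ((?V t * f t) * cnj (f t) + f' t * cnj (f' t)) =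
      (t\<^sup>2 + Re (q t) - Re lam) * (norm (f t))\<^sup>2 + (norm (f' t))\<^sup>2" for t
  proof -
    have "(?V t * f t) * cnj (f t) + f' t * cnj (f' t) = ?V t * of_real ((norm (f t))\<^sup>2) + of_real ((norm (f' t))\<^sup>2)"
      by (simp only: mult.assoc complex_norm_square)
    then show ?thesis by simp
  qed
  ultimately show ?thesis by simp
qed

text \<open>\<open>J\<close> is half the derivative of \<open>|f|\<^sup>2\<close>. Beyond
  \<open>X\<close> the coefficient \<open>t\<^sup>2 + Re q - Re lam\<close> is at least 1, so
  \<open>J\<close> increases; a positive value would make \<open>|f|\<^sup>2\<close> grow at least
  linearly, against integrability.\<close>

lemma L2_solution_energy:
  assumes f: "is_sol q lam f f'" and L2: "integrable lborel (\<lambda>x. (norm (f x))\<^sup>2)"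
    and X: "X = 1 + C + norm lam"
  defines "J \<equiv> \<lambda>x. Re (f' x * cnj (f x))"
  shows "X \<le> a \<Longrightarrow> a \<le> b \<Longrightarrow> integral {a..b} (\<lambda>t. (norm (f t))\<^sup>2 + (norm (f' t))\<^sup>2) \<le> J b - J a"
    and "X \<le> a \<Longrightarrow> J a \<le> 0"
proof -
  have fd: "\<And>x. (f has_vector_derivative f' x) (at x)" using f by (simp add: is_sol_def)
  have fc: "continuous_on A f" for A by (rule is_sol_continuous[OF f])
  have f'c: "continuous_on A f'" for A by (rule is_sol_derivative_continuous[OF f])
  show le: "integral {a..b} (\<lambda>t. (norm (f t))\<^sup>2 + (norm (f' t))\<^sup>2) \<le> J b - J a"
    if a: "X \<le> a" and ab: "a \<le> b" for a b
  proof (rule has_integral_le)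
    show "((\<lambda>t. (norm (f t))\<^sup>2 + (norm (f' t))\<^sup>2) has_integral
        integral {a..b} (\<lambda>t. (norm (f t))\<^sup>2 + (norm (f' t))\<^sup>2)) {a..b}"
      by (intro integrable_integral integrable_continuous_real continuous_intros fc f'c)
    show "((\<lambda>t. (t\<^sup>2 + Re (q t) - Re lam) * (norm (f t))\<^sup>2 + (norm (f' t))\<^sup>2) has_integral J b - J a) {a..b}"
      unfolding J_def by (rule is_sol_mult_cnj[OF f ab])
    fix t assume "t \<in> {a..b}"
    then have "t \<ge> X" using a by simp
    moreover have "X \<ge> 1" using C_nonneg X by simp
    ultimately have "t\<^sup>2 \<ge> X" using self_le_power[of t 2] by simp
    moreover have "- C \<le> Re (q t)" using abs_Re_le_cmod[of "q t"] q_bound[of t] by linarith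
    moreover have "Re lam \<le> norm lam" by (rule complex_Re_le_cmod)
    ultimately have "1 \<le> t\<^sup>2 + Re (q t) - Re lam" using X by linarith
    from mult_right_mono[OF this, of "(norm (f t))\<^sup>2"]
    show "(norm (f t))\<^sup>2 + (norm (f' t))\<^sup>2 \<le> (t\<^sup>2 + Re (q t) - Re lam) * (norm (f t))\<^sup>2 + (norm (f' t))\<^sup>2"
      by simp
  qed
  have mono: "J a \<le> J b" if "X \<le> a" "a \<le> b" for a b
  proof -
    have "0 \<le> integral {a..b} (\<lambda>t. (norm (f t))\<^sup>2 + (norm (f' t))\<^sup>2)"
      by (intro integral_nonneg integrable_continuous_real continuous_intros fc f'c) auto
    with le[OF that] show ?thesis by linarith
  qed
  show "J a \<le> 0" if a: "X \<le> a"
  proof (rule ccontr)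
    assume "\<not> J a \<le> 0"
    then have Ja: "J a > 0" by simp
    have d: "((\<lambda>x. (norm (f x))\<^sup>2) has_real_derivative 2 * J x) (at x)" for x
    proof -
      have "((\<lambda>x. cnj (f x)) has_vector_derivative cnj (f' x)) (at x)"
        by (rule bounded_linear.has_vector_derivative[OF bounded_linear_cnj fd])
      from bounded_linear.has_vector_derivative[OF bounded_linear_Re has_vector_derivative_mult[OF fd this]]
      have "((\<lambda>x. Re (f x * cnj (f x))) has_vector_derivative 2 * J x) (at x)"
        by (simp add: J_def mult.commute)
      moreover have "(norm (f x))\<^sup>2 = Re (f x * cnj (f x))" for x
        by (metis Re_complex_of_real complex_norm_square)
      ultimately show ?thesis
        by (simp only: has_real_derivative_iff_has_vector_derivative)
    qed
    \<comment> \<open>A positive lower bound on a half-line already contradicts integrability;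
      starting at \<open>a + 1\<close> ensures \<open>x - a \<ge> 1\<close>.\<close>
    have big: "2 * J a \<le> (norm (f x))\<^sup>2" if x: "a + 1 \<le> x" for x
    proof -
      have "(norm (f a))\<^sup>2 - 2 * J a * a \<le> (norm (f x))\<^sup>2 - 2 * J a * x"
      proof (rule DERIV_nonneg_imp_nondecreasing[of a x "\<lambda>t. (norm (f t))\<^sup>2 - 2 * J a * t"])
        show "a \<le> x" using x by simp
        fix t assume t: "a \<le> t" "t \<le> x"
        have "((\<lambda>t. (norm (f t))\<^sup>2 - 2 * J a * t) has_real_derivative 2 * J t - 2 * J a * 1) (at t)"
          by (intro DERIV_diff d DERIV_cmult DERIV_ident)
        moreover have "J a \<le> J t" by (rule mono[OF a t(1)])
        ultimately show "\<exists>y. ((\<lambda>t. (norm (f t))\<^sup>2 - 2 * J a * t) has_real_derivative y) (at t) \<and> 0 \<le> y"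
          by (intro exI[of _ "2 * J t - 2 * J a * 1"]) auto
      qed
      then have "2 * J a * (x - a) \<le> (norm (f x))\<^sup>2"
        using zero_le_power2[of "norm (f a)"] by (simp only: right_diff_distrib)
      moreover have "2 * J a * 1 \<le> 2 * J a * (x - a)" using Ja x by (intro mult_left_mono) auto
      ultimately show ?thesis by linarith
    qed
    define I where "I = integral\<^sup>L lborel (\<lambda>x. (norm (f x))\<^sup>2)"
    have lb: "2 * J a * real k \<le> I" for k :: nat
    proof -
      let ?S = "{a + 1..a + 1 + real k}"
      have "integral\<^sup>L lborel (\<lambda>x. 2 * J a * indicator ?S x) \<le> I"
        unfolding I_def
      proof (rule integral_mono[OF _ L2])
        show "integrable lborel (\<lambda>x. 2 * J a * indicator ?S x)"
          by (intro integrable_mult_right integrable_real_indicator) auto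
        show "2 * J a * indicator ?S x \<le> (norm (f x))\<^sup>2" for x
          using big[of x] by (auto simp: indicator_def)
      qed
      then show ?thesis by simp
    qed
    obtain k :: nat where "I / (2 * J a) < real k" using reals_Archimedean2 by blast
    then have "I < real k * (2 * J a)" using Ja by (simp only: pos_divide_less_eq)
    with lb[of k] show False by (simp add: mult_ac)
  qed
qed

text \<open>Pairing \<open>f\<close> with \<open>g'\<close> and \<open>f'\<close> with
  \<open>g\<close> in \<open>2 s t \<le> s\<^sup>2 + t\<^sup>2\<close> bounds \<open>2 |k|\<close>
  by the two energy densities. So \<open>H\<close> gains at least \<open>2 |k|\<close> per unit
  interval while never exceeding 0 beyond \<open>X\<close>.\<close>

lemma L2_solutions_wronskian_zero:
  assumes f: "is_sol q lam f f'" and g: "is_sol q lam g g'"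
    and L2: "integrable lborel (\<lambda>x. (norm (f x))\<^sup>2)" "integrable lborel (\<lambda>x. (norm (g x))\<^sup>2)"
  shows "f x * g' x - f' x * g x = 0"
proof -
  define k where "k = f x * g' x - f' x * g x"
  have k: "k = f t * g' t - f' t * g t" for t
    unfolding k_def by (rule wronskian_const[OF f g])
  define X where "X = 1 + C + norm lam"
  define H where "H x = Re (f' x * cnj (f x)) + Re (g' x * cnj (g x))" for x
  note ef = L2_solution_energy[OF f L2(1) X_def] and eg = L2_solution_energy[OF g L2(2) X_def]
  have H0: "H a \<le> 0" if "X \<le> a" for a
    using ef(2)[OF that] eg(2)[OF that] by (simp add: H_def)
  let ?F = "\<lambda>t. (norm (f t))\<^sup>2 + (norm (f' t))\<^sup>2" and ?G = "\<lambda>t. (norm (g t))\<^sup>2 + (norm (g' t))\<^sup>2"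
  have step: "H a + 2 * norm k \<le> H (a + 1)" if a: "X \<le> a" for a
  proof -
    have int: "?F integrable_on {a..a + 1}" "?G integrable_on {a..a + 1}"
      by (intro integrable_continuous_real continuous_intros is_sol_continuous[OF f]
          is_sol_continuous[OF g] is_sol_derivative_continuous[OF f] is_sol_derivative_continuous[OF g])+
    have pw: "2 * norm k \<le> ?F t + ?G t" for t
    proof -
      have "norm k \<le> norm (f t) * norm (g' t) + norm (f' t) * norm (g t)"
        unfolding k[of t] using norm_triangle_ineq4[of "f t * g' t" "f' t * g t"] by (simp add: norm_mult)
      moreover have "2 * (norm (f t) * norm (g' t)) \<le> (norm (f t))\<^sup>2 + (norm (g' t))\<^sup>2"
        using sum_squares_bound[of "norm (f t)" "norm (g' t)"] by simp
      moreover have "2 * (norm (f' t) * norm (g t)) \<le> (norm (f' t))\<^sup>2 + (norm (g t))\<^sup>2"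
        using sum_squares_bound[of "norm (f' t)" "norm (g t)"] by simp
      ultimately show ?thesis by linarith
    qed
    have "2 * norm k = integral {a..a + 1} (\<lambda>t. 2 * norm k)" by simp
    also have "\<dots> \<le> integral {a..a + 1} (\<lambda>t. ?F t + ?G t)"
      by (intro integral_le integrable_add int pw) auto
    also have "\<dots> = integral {a..a + 1} ?F + integral {a..a + 1} ?G"
      by (intro Henstock_Kurzweil_Integration.integral_add int)
    also have "\<dots> \<le> H (a + 1) - H a"
      using ef(1)[OF a, of "a + 1"] eg(1)[OF a, of "a + 1"] by (simp add: H_def)
    finally show ?thesis by linarith
  qed
  have grow: "H X + 2 * norm k * real n \<le> H (X + real n)" for n
  proof (induction n)
    case (Suc n)
    have "H (X + real n) + 2 * norm k \<le> H (X + real n + 1)" by (rule step) auto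
    with Suc show ?case by (simp add: algebra_simps)
  qed auto
  have bounded: "real n * norm k \<le> - H X / 2" for n
    using grow[of n] H0[of "X + real n"] by (simp add: mult.commute)
  have "norm k = 0"
  proof (rule ccontr)
    assume "norm k \<noteq> 0"
    then have "norm k > 0" by simp
    obtain n :: nat where "(- H X / 2) / norm k < real n" using reals_Archimedean2 by blast
    then have "- H X / 2 < real n * norm k" using \<open>norm k > 0\<close> by (simp only: pos_divide_less_eq)
    with bounded[of n] show False by linarith
  qed
  then show ?thesis by (simp add: k_def)
qed

lemma simple_eigenvalues: "only_simple_eigenvalues q"
  unfolding only_simple_eigenvalues_def
proof (intro allI impI)
  fix lam f g assume "eigenfunction q lam f \<and> eigenfunction q lam g"
  then obtain f' g' where f: "is_sol q lam f f'" "integrable lborel (\<lambda>x. (norm (f x))\<^sup>2)" "f \<noteq> (\<lambda>_. 0)"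
    and g: "is_sol q lam g g'" "integrable lborel (\<lambda>x. (norm (g x))\<^sup>2)"
    unfolding eigenfunction_def L2_def by blast
  obtain x0 where "f x0 \<noteq> 0" using f(3) by blast
  from wronskian_zero_imp_proportional[OF f(1) g(1) L2_solutions_wronskian_zero[OF f(1) g(1) f(2) g(2)] this]
  show "\<exists>c. g = (\<lambda>x. c * f x)" by blast
qed

section \<open>Reflection to minus infinity\<close>

lemma bounded_potential_reflect: "bounded_potential (\<lambda>x. q (- x)) (\<lambda>x. - q1 (- x)) C"
proof unfold_locales
  show "(\<lambda>x. q (- x)) \<in> borel_measurable borel" using q_measurable by measurable
  show "((\<lambda>x. q (- x)) has_integral - q1 (- b) - - q1 (- a)) {a..b}" if "a \<le> b" for a b
    using has_integral_reflect_real[of q "q1 (- a) - q1 (- b)" "-a" "-b"] q1_integral[of "-b" "-a"] that by simp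
qed (use q_bound q1_bound in auto)

end

lemma is_sol_reflect:
  assumes "is_sol q lam y y'"
  shows "is_sol (\<lambda>x. q (- x)) lam (\<lambda>x. y (- x)) (\<lambda>x. - y' (- x))"
  unfolding is_sol_def
proof (intro conjI allI impI)
  fix x
  have "(y has_vector_derivative y' (- x)) (at (- x))" using assms by (simp add: is_sol_def)
  moreover have "(uminus has_vector_derivative - 1) (at x)" by (auto intro!: derivative_eq_intros)
  ultimately show "((\<lambda>x. y (- x)) has_vector_derivative - y' (- x)) (at x)"
    using vector_diff_chain_at[of uminus "- 1" x y] by (simp add: o_def)
next
  fix a b :: real assume "a \<le> b"
  then have "((\<lambda>t. (complex_of_real (t\<^sup>2) + q t - lam) * y t) has_integral (y' (- a) - y' (- b))) {- b..- a}"
    using assms by (simp add: is_sol_def)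
  then show "((\<lambda>t. (complex_of_real (t\<^sup>2) + q (- t) - lam) * y (- t)) has_integral (- y' (- b) - - y' (- a))) {a..b}"
    using has_integral_reflect_real[of "\<lambda>t. (complex_of_real (t\<^sup>2) + q t - lam) * y t" "y' (- a) - y' (- b)" "-a" "-b"] by simp
qed

lemma Aplus_minus: "Aplus (- x) lam = Aminus x lam"
  by (simp add: Aplus_def Aminus_def)

lemma uniform_limit_at_bot_mirror:
  "uniform_limit K f l at_bot \<longleftrightarrow> uniform_limit K (\<lambda>x. f (- x)) l (at_top :: real filter)"
  by (simp add: uniform_limit_iff at_bot_mirror eventually_filtermap)

context bounded_potential
begin

text \<open>Reflection changes the sign of both \<open>psi'\<close> and \<open>x\<close>, so the
  quotient by \<open>- x Aminus\<close> keeps its form; uniqueness transfers by reflecting the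
  competitor.\<close>

lemma recessive_solution_at_bot:
  "\<exists>psi psi' :: real \<Rightarrow> complex \<Rightarrow> complex.
    (\<forall>lam. is_sol q lam (\<lambda>x. psi x lam) (\<lambda>x. psi' x lam)) \<and>
    (\<forall>K. compact K \<longrightarrow>
       uniform_limit K (\<lambda>x lam. psi x lam / Aminus x lam) (\<lambda>_. 1) at_bot \<and>
       uniform_limit K (\<lambda>x lam. psi' x lam / (- of_real x * Aminus x lam)) (\<lambda>_. 1) at_bot) \<and>
    (\<forall>lam y y'. is_sol q lam y y' \<and>
       ((\<lambda>x. y x / Aminus x lam) \<longlongrightarrow> 1) at_bot \<and>
       ((\<lambda>x. y' x / (- of_real x * Aminus x lam)) \<longlongrightarrow> 1) at_bot
       \<longrightarrow> y = (\<lambda>x. psi x lam)) \<and>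
    (\<forall>x. psi x holomorphic_on UNIV \<and> psi' x holomorphic_on UNIV)"
proof -
  have Am: "Aminus (- x) lam = Aplus x lam" for x lam
    using Aplus_minus[of "- x" lam] by simp
  obtain phi phi' :: "real \<Rightarrow> complex \<Rightarrow> complex" where
    sol: "\<forall>lam. is_sol (\<lambda>x. q (- x)) lam (\<lambda>x. phi x lam) (\<lambda>x. phi' x lam)"
    and ul: "\<forall>K. compact K \<longrightarrow>
       uniform_limit K (\<lambda>x lam. phi x lam / Aplus x lam) (\<lambda>_. 1) at_top \<and>
       uniform_limit K (\<lambda>x lam. phi' x lam / (- of_real x * Aplus x lam)) (\<lambda>_. 1) at_top"
    and uniq: "\<forall>lam y y'. is_sol (\<lambda>x. q (- x)) lam y y' \<and>
       ((\<lambda>x. y x / Aplus x lam) \<longlongrightarrow> 1) at_top \<and>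
       ((\<lambda>x. y' x / (- of_real x * Aplus x lam)) \<longlongrightarrow> 1) at_top \<longrightarrow> y = (\<lambda>x. phi x lam)"
    and hol: "\<forall>x. phi x holomorphic_on UNIV \<and> phi' x holomorphic_on UNIV"
    using bounded_potential.recessive_solution_at_top[OF bounded_potential_reflect]
    by (elim exE conjE) (rule that)
  define psi where "psi x lam = phi (- x) lam" for x lam
  define psi' where "psi' x lam = - phi' (- x) lam" for x lam
  have sols: "is_sol q lam (\<lambda>x. psi x lam) (\<lambda>x. psi' x lam)" for lam
    using is_sol_reflect[OF sol[rule_format, of lam]] by (simp add: psi_def psi'_def)
  have uls: "uniform_limit K (\<lambda>x lam. psi x lam / Aminus x lam) (\<lambda>_. 1) at_bot"
    "uniform_limit K (\<lambda>x lam. psi' x lam / (- of_real x * Aminus x lam)) (\<lambda>_. 1) at_bot"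
    if "compact K" for K
    using ul[rule_format, OF that] by (simp_all add: uniform_limit_at_bot_mirror psi_def psi'_def Am)
  have uniqs: "y = (\<lambda>x. psi x lam)"
    if "is_sol q lam y y'" "((\<lambda>x. y x / Aminus x lam) \<longlongrightarrow> 1) at_bot"
      "((\<lambda>x. y' x / (- of_real x * Aminus x lam)) \<longlongrightarrow> 1) at_bot" for lam y y'
  proof -
    have "((\<lambda>x. y (- x) / Aplus x lam) \<longlongrightarrow> 1) at_top"
      "((\<lambda>x. - y' (- x) / (- of_real x * Aplus x lam)) \<longlongrightarrow> 1) at_top"
      using that(2,3) by (simp_all add: filterlim_at_bot_mirror Am)
    with is_sol_reflect[OF that(1)] have e: "(\<lambda>x. y (- x)) = (\<lambda>x. phi x lam)"
      by (intro uniq[rule_format] conjI)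
    show ?thesis
    proof
      fix x show "y x = psi x lam" using fun_cong[OF e, of "- x"] by (simp add: psi_def)
    qed
  qed
  have hols: "psi x holomorphic_on UNIV" "psi' x holomorphic_on UNIV" for x
    unfolding psi_def[abs_def] psi'_def[abs_def] using hol by (auto intro!: holomorphic_on_minus)
  show ?thesis
    by (intro exI[of _ psi] exI[of _ psi'] conjI allI impI;
        (rule sols hols | (rule uls, assumption) | (elim conjE, rule uniqs, assumption+)))
qed

end

section \<open>Representatives of essentially bounded potentials\<close>

lemma is_sol_cong_AE:
  assumes "AE x in lborel. q x = r x"
  shows "is_sol q lam y y' \<longleftrightarrow> is_sol r lam y y'"
proof -
  have "((\<lambda>t. (complex_of_real (t\<^sup>2) + q t - lam) * y t) has_integral I) S \<longleftrightarrow>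
        ((\<lambda>t. (complex_of_real (t\<^sup>2) + r t - lam) * y t) has_integral I) S" for S I
    by (rule has_integral_AE) (use assms in \<open>auto elim: eventually_mono\<close>)
  then show ?thesis by (simp add: is_sol_def)
qed

text \<open>A violation at one point persists, by continuity, on an interval, which is not null.
  This turns the essential bound on \<open>q1\<close> into a bound everywhere.\<close>

lemma AE_lborel_imp_all_continuous:
  fixes f :: "real \<Rightarrow> 'a::real_normed_vector"
  assumes "continuous_on UNIV f" and AE: "AE x in lborel. norm (f x) \<le> C"
  shows "norm (f x) \<le> C"
proof (rule ccontr)
  assume "\<not> norm (f x) \<le> C"
  then have x: "x \<in> {x. norm (f x) > C}" by simp
  have "open {x. norm (f x) > C}"
    by (intro open_Collect_less continuous_intros assms)
  then obtain e where e: "e > 0" "ball x e \<subseteq> {x. norm (f x) > C}"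
    using x open_contains_ball by blast
  from AE obtain N where N: "{x. \<not> norm (f x) \<le> C} \<subseteq> N" "N \<in> null_sets lborel"
    by (auto elim!: AE_E simp: null_sets_def)
  have "{x - e / 2..x + e / 2} \<subseteq> N"
  proof
    fix y assume "y \<in> {x - e / 2..x + e / 2}"
    then have "\<bar>x - y\<bar> \<le> e / 2" unfolding abs_le_iff atLeastAtMost_iff by linarith
    then have "dist x y \<le> e / 2" by (simp only: dist_real_def)
    then have "y \<in> ball x e" using e(1) by simp
    with e(2) N(1) show "y \<in> N" by (auto simp: not_le)
  qed
  then have "emeasure lborel {x - e / 2..x + e / 2} \<le> emeasure lborel N"
    using N(2) by (intro emeasure_mono) auto
  then show False using N(2) e(1) by (simp add: null_sets_def)
qed

text \<open>\<open>q\<close> is set to 0 on the null set where it is too large. Integrals do not see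
  the change, so the integral of \<open>r\<close> from 0 equals that of \<open>q\<close> at every
  point and inherits its essential bound.\<close>

lemma essentially_bounded_imp_bounded_potential:
  fixes q :: "real \<Rightarrow> complex"
  assumes meas: "q \<in> borel_measurable lborel"
    and C1: "\<exists>C. AE x in lborel. norm (q x) \<le> C"
    and C2: "\<exists>C. AE x in lborel. norm (LBINT t=0..x. q t) \<le> C"
  obtains r r1 C where "bounded_potential r r1 C" "AE x in lborel. q x = r x"
proof -
  from C1 C2 obtain A B where A: "AE x in lborel. norm (q x) \<le> A"
    and B: "AE x in lborel. norm (LBINT t=0..x. q t) \<le> B" by blast
  define C where "C = max (max A B) 0"
  define r where "r x = (if norm (q x) \<le> C then q x else 0)" for x
  define r1 where "r1 x = (LBINT t=0..x. r t)" for x :: real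
  have [measurable]: "q \<in> borel_measurable borel" using meas by simp
  have rm[measurable]: "r \<in> borel_measurable borel" unfolding r_def by measurable
  have eq: "AE x in lborel. q x = r x"
    using A by eventually_elim (auto simp: r_def C_def)
  have rb: "norm (r x) \<le> C" for x by (auto simp: r_def C_def)
  have si: "set_integrable lborel {a..b} r" for a b :: real
    unfolding set_integrable_def
  proof (rule Bochner_Integration.integrable_bound)
    show "integrable lborel (\<lambda>x. C * indicator {a..b} x)"
      by (intro integrable_mult_right integrable_real_indicator) (auto simp: emeasure_lborel_Icc_eq)
    show "AE x in lborel. norm (indicator {a..b} x *\<^sub>R r x) \<le> norm (C * indicator {a..b} x)"
      using order_trans[OF rb abs_ge_self] by (intro AE_I2) (simp add: indicator_def)
  qed measurable
  have ii: "interval_lebesgue_integrable lborel (ereal a) (ereal b) r" for a b :: real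
    unfolding interval_lebesgue_integrable_def
    by (auto intro: set_integrable_subset[OF si[of a b]] set_integrable_subset[OF si[of b a]])
  have int: "(r has_integral (r1 b - r1 a)) {a..b}" if "a \<le> b" for a b
  proof -
    have "(LBINT t=0..a. r t) + (LBINT t=a..b. r t) = (LBINT t=0..b. r t)"
      using interval_integral_sum[of 0 "ereal a" "ereal b" r] ii
      by (auto simp: zero_ereal_def min_def max_def)
    moreover have "(LBINT t=a..b. r t) = integral {a..b} r"
      by (rule interval_integral_eq_integral[OF that si])
    moreover have "(r has_integral integral {a..b} r) {a..b}"
      by (intro integrable_integral set_borel_integral_eq_integral(1) si)
    ultimately show ?thesis by (metis r1_def add_diff_cancel_left')
  qed
  have C0: "C \<ge> 0" by (simp add: C_def)
  have lip: "norm (r1 x - r1 y) \<le> C * \<bar>x - y\<bar>" for x y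
  proof -
    have *: "norm (r1 x - r1 y) \<le> C * (x - y)" if "y \<le> x" for x y
      using has_integral_bound_real[OF C0 finite.emptyI int[OF that]] rb that by auto
    show ?thesis using *[of x y] *[of y x] by (cases "x \<le> y") (auto simp: norm_minus_commute)
  qed
  have cont: "continuous_on UNIV r1"
  proof -
    have "C-lipschitz_on UNIV r1"
      by (rule lipschitz_onI) (use lip C0 in \<open>auto simp: dist_norm dist_real_def\<close>)
    then show ?thesis by (rule lipschitz_on_continuous_on)
  qed
  have "r1 x = (LBINT t=0..x. q t)" for x :: real
    unfolding r1_def
    by (rule interval_integral_cong_AE) (use eq in \<open>auto elim: eventually_mono\<close>)
  with B have "AE x in lborel. norm (r1 x) \<le> C"
    by (auto simp: C_def elim!: eventually_mono)
  from AE_lborel_imp_all_continuous[OF cont this] rb int rm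
  have "bounded_potential r r1 C" by unfold_locales auto
  with eq show ?thesis by (rule that[rotated])
qed

theorem theorem2p1:
  fixes q :: "real \<Rightarrow> complex"
  assumes q_meas: "q \<in> borel_measurable lborel"
    and q_Linf: "\<exists>C. AE x in lborel. norm (q x) \<le> C"
    and q1_Linf: "\<exists>C. AE x in lborel. norm (LBINT t=0..x. q t) \<le> C"
  shows "(\<exists>psip psip' psim psim' :: real \<Rightarrow> complex \<Rightarrow> complex.
            (\<forall>lam. is_sol q lam (\<lambda>x. psip x lam) (\<lambda>x. psip' x lam)) \<and>
            (\<forall>lam. is_sol q lam (\<lambda>x. psim x lam) (\<lambda>x. psim' x lam)) \<and>
            (\<forall>K. compact K \<longrightarrow>
               uniform_limit K (\<lambda>x lam. psip x lam / Aplus x lam) (\<lambda>_. 1) at_top \<and>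
               uniform_limit K (\<lambda>x lam. psip' x lam / (- of_real x * Aplus x lam)) (\<lambda>_. 1) at_top \<and>
               uniform_limit K (\<lambda>x lam. psim x lam / Aminus x lam) (\<lambda>_. 1) at_bot \<and>
               uniform_limit K (\<lambda>x lam. psim' x lam / (- of_real x * Aminus x lam)) (\<lambda>_. 1) at_bot) \<and>
            (\<forall>lam y y'. is_sol q lam y y' \<and>
               ((\<lambda>x. y x / Aplus x lam) \<longlongrightarrow> 1) at_top \<and>
               ((\<lambda>x. y' x / (- of_real x * Aplus x lam)) \<longlongrightarrow> 1) at_top
               \<longrightarrow> y = (\<lambda>x. psip x lam)) \<and>
            (\<forall>lam y y'. is_sol q lam y y' \<and>
               ((\<lambda>x. y x / Aminus x lam) \<longlongrightarrow> 1) at_bot \<and>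
               ((\<lambda>x. y' x / (- of_real x * Aminus x lam)) \<longlongrightarrow> 1) at_bot
               \<longrightarrow> y = (\<lambda>x. psim x lam)) \<and>
            (\<forall>x. (\<lambda>lam. psip x lam) holomorphic_on UNIV \<and>
                 (\<lambda>lam. psip' x lam) holomorphic_on UNIV \<and>
                 (\<lambda>lam. psim x lam) holomorphic_on UNIV \<and>
                 (\<lambda>lam. psim' x lam) holomorphic_on UNIV \<and>
                 (\<lambda>lam. psim x lam * psip' x lam - psim' x lam * psip x lam) holomorphic_on UNIV))
       \<and> ((\<forall>x. Im (q x) = 0) \<longrightarrow> only_simple_eigenvalues q)"
proof (rule essentially_bounded_imp_bounded_potential[OF assms])
  fix r r1 C assume "bounded_potential r r1 C" and eq: "AE x in lborel. q x = r x"
  then interpret bounded_potential r r1 C by simp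
  \<comment> \<open>Solutions, and with them eigenfunctions, depend on \<open>q\<close> only up to
    null sets, so the results for \<open>r\<close> transfer verbatim.\<close>
  have sol_eq: "is_sol q = is_sol r"
    using is_sol_cong_AE[OF eq] by (intro ext)
  obtain psip psip' :: "real \<Rightarrow> complex \<Rightarrow> complex" where P:
    "\<forall>lam. is_sol r lam (\<lambda>x. psip x lam) (\<lambda>x. psip' x lam)"
    "\<forall>K. compact K \<longrightarrow>
       uniform_limit K (\<lambda>x lam. psip x lam / Aplus x lam) (\<lambda>_. 1) at_top \<and>
       uniform_limit K (\<lambda>x lam. psip' x lam / (- of_real x * Aplus x lam)) (\<lambda>_. 1) at_top"
    "\<forall>lam y y'. is_sol r lam y y' \<and>
       ((\<lambda>x. y x / Aplus x lam) \<longlongrightarrow> 1) at_top \<and>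
       ((\<lambda>x. y' x / (- of_real x * Aplus x lam)) \<longlongrightarrow> 1) at_top
       \<longrightarrow> y = (\<lambda>x. psip x lam)"
    "\<forall>x. psip x holomorphic_on UNIV \<and> psip' x holomorphic_on UNIV"
    using recessive_solution_at_top by (elim exE conjE) (rule that)
  obtain psim psim' :: "real \<Rightarrow> complex \<Rightarrow> complex" where M:
    "\<forall>lam. is_sol r lam (\<lambda>x. psim x lam) (\<lambda>x. psim' x lam)"
    "\<forall>K. compact K \<longrightarrow>
       uniform_limit K (\<lambda>x lam. psim x lam / Aminus x lam) (\<lambda>_. 1) at_bot \<and>
       uniform_limit K (\<lambda>x lam. psim' x lam / (- of_real x * Aminus x lam)) (\<lambda>_. 1) at_bot"
    "\<forall>lam y y'. is_sol r lam y y' \<and>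
       ((\<lambda>x. y x / Aminus x lam) \<longlongrightarrow> 1) at_bot \<and>
       ((\<lambda>x. y' x / (- of_real x * Aminus x lam)) \<longlongrightarrow> 1) at_bot
       \<longrightarrow> y = (\<lambda>x. psim x lam)"
    "\<forall>x. psim x holomorphic_on UNIV \<and> psim' x holomorphic_on UNIV"
    using recessive_solution_at_bot by (elim exE conjE) (rule that)
  have W: "(\<lambda>lam. psim x lam * psip' x lam - psim' x lam * psip x lam) holomorphic_on UNIV" for x
    using P(4) M(4) by (intro holomorphic_on_diff holomorphic_on_mult) auto
  have E: "only_simple_eigenvalues q"
  proof -
    have "eigenfunction q lam f \<longleftrightarrow> eigenfunction r lam f" for lam f
      by (simp add: eigenfunction_def sol_eq)
    then show ?thesis using simple_eigenvalues by (simp add: only_simple_eigenvalues_def)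
  qed
  show ?thesis
    unfolding sol_eq
    by (rule conjI, rule exI[of _ psip], rule exI[of _ psip'], rule exI[of _ psim], rule exI[of _ psim'];
        intro conjI allI impI;
        (rule P(1)[rule_format] M(1)[rule_format] W E P(3)[rule_format] M(3)[rule_format]
           P(4)[rule_format, THEN conjunct1] P(4)[rule_format, THEN conjunct2]
           M(4)[rule_format, THEN conjunct1] M(4)[rule_format, THEN conjunct2]
           P(2)[rule_format, THEN conjunct1] P(2)[rule_format, THEN conjunct2]
           M(2)[rule_format, THEN conjunct1] M(2)[rule_format, THEN conjunct2], assumption?))
qed

end
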